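(* In the setting described in the context ($\sigma^2$ known, no candidate model correct), suppose that $(n-k)/n\to 0$ as $n\to\infty$ and that: (i) $\displaystyle\sum_{\alpha\in\mathcal A_n}\frac{1}{[nR_n(\alpha)]^m}\to 0$ for some positive integer $m$ for which $E(e_1^{4m})<\infty$; (ii) $\displaystyle\frac{p_n\lambda_n}{\min_{\alpha\in\mathcal A_n} nR_n(\alpha)}\to 0$, where $\lambda_n=\log\frac{n}{n-k}$; (iii) $\displaystyle\max_{\alpha\in\mathcal A_n}\frac{\frac1r\sum_{i=1}^r a_{in}(\alpha)}{nR_n(\alpha)}\to 0$. Then: (a) $\Gamma(\alpha)=\frac{k}{n^2}\mathbf e'\mathbf e+L_n(\alpha)+o_p(L_n(\alpha))$ uniformly in $\alpha\in\mathcal A_n$, i.e. $\displaystyle\max_{\alpha\in\mathcal A_n}\frac{|\Gamma(\alpha)-\frac{k}{n^2}\mathbf e'\mathbf e-L_n(\alpha)|}{L_n(\alpha)}\to 0$ in probability. (b) The model selection rule is asymptotically optimal: if $\hat\alpha_n\in\mathcal A_n$ is the selected model, i.e. a minimizer of $\Gamma(\alpha)$ over $\alpha\in\mathcal A_n$, then $\displaystyle\frac{L_n(\hat\alpha_n)}{\min_{\alpha\in\mathcal A_n}L_n(\alpha)}\to 1$ in probability.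
   Context: Data. For each $n$, $\mathbf y=\boldsymbol\mu+\mathbf e\in\mathbb R^n$, where $\boldsymbol\mu=\boldsymbol\mu_n\in\mathbb R^n$ is a fixed (unknown) mean vector and $\mathbf e=(e_1,\dots,e_n)'$ has independent components with mean $0$ and common variance $\sigma^2$. $X=X_n$ is a given $n\times p_n$ matrix. All limits are as $n\to\infty$; $p_n,k,r,\mathcal A_n,X,\boldsymbol\mu$ may depend on $n$. Models. $\mathcal A_n$ is a collection of nonempty subsets $\alpha\subset\{1,\dots,p_n\}$; $p_n(\alpha)=|\alpha|$ and $X(\alpha)$ is the $n\times p_n(\alpha)$ submatrix of $X$ with columns indexed by $\alpha$. Put $P(\alpha)=X(\alpha)(X'(\alpha)X(\alpha))^{-1}X'(\alpha)$, $\hat{\boldsymbol\beta}(\alpha)=(X'(\alpha)X(\alpha))^{-1}X'(\alpha)\mathbf y$. No model is correct: $\boldsymbol\mu$ is not in the column space of $X(\alpha)$ for any $\alpha\in\mathcal A_n$. Training samples. $1\le k<n$, $n-k\to\infty$. There are $r$ training samples, the $i$-th given by an index set $T_i\subset\{1,\dots,n\}$ with $|T_i|=n-k$; each index $j\in\{1,\dots,n\}$ belongs to the same number of the sets $T_1,\dots,T_r$. $\mathbf y_i$ is the subvector of $\mathbf y$ indexed by $T_i$, and $X_i(\alpha)$ is the submatrix of $X(\alpha)$ consisting of the rows indexed by $T_i$. $X_i'(\alpha)X_i(\alpha)$ is nonsingular for every $i$ and every $\alpha\in\mathcal A_n$, and $\hat{\boldsymbol\beta}_i(\alpha)=[X_i'(\alpha)X_i(\alpha)]^{-1}X_i'(\alpha)\mathbf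 y_i$. Loss and risk. $L_n(\alpha)=\frac1n\|\boldsymbol\mu-P(\alpha)\mathbf y\|^2$, $\Delta_n(\alpha)=\frac1n\boldsymbol\mu'(I-P(\alpha))\boldsymbol\mu$, $nR_n(\alpha)=E(nL_n(\alpha))=n\Delta_n(\alpha)+\sigma^2p_n(\alpha)$. Criterion ($\sigma^2$ known). $$\Gamma(\alpha)=\frac1n\|\mathbf y-X(\alpha)\hat{\boldsymbol\beta}(\alpha)\|^2-\frac1r\sum_{i=1}^r\frac1n\|\mathbf y_i-X_i(\alpha)\hat{\boldsymbol\beta}_i(\alpha)\|^2+\frac1r\sum_{i=1}^r\frac{\sigma^2}{n}\log\frac{|X'(\alpha)X(\alpha)|}{|X_i'(\alpha)X_i(\alpha)|},$$ where $|\cdot|$ of a matrix is its determinant. Minimizing $\Gamma$ is equivalent to maximizing the average over $i$ of the log cross-validatory predictive densities of the observations outside $T_i$ given $\mathbf y_i$, under the model $\mathbf y\sim N(X(\alpha)\boldsymbol\beta(\alpha),\sigma^2I_n)$ with flat prior on $\boldsymbol\beta(\alpha)$. Also $$a_{in}(\alpha)=\log\left\{\frac{(n-k)^{p_n(\alpha)}|X'(\alpha)X(\alpha)|}{n^{p_n(\alpha)}|X_i'(\alpha)X_i(\alpha)|}\right\}.$$ *)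

theory Defs
  imports
    "HOL-Probability.Probability"
    "Jordan_Normal_Form.DL_Submatrix"
    "Jordan_Normal_Form.Determinant"
    "Jordan_Normal_Form.Gauss_Jordan_Elimination"
    "Jordan_Normal_Form.VS_Connect"
begin

text \<open>
  Row, column, observation and training-sample indices are 0-based, as in the matrix library:
  a model is a set of column indices below the number of columns of the design matrix, a
  training sample a set of row indices below \<open>n\<close>, and the paper's \<open>e\<^sub>1\<close> is \<open>e 0\<close>.
\<close>

definition sq_norm :: "real Matrix.vec \<Rightarrow> real" where
  "sq_norm v = scalar_prod v v"

text \<open>\<^term>\<open>the\<close> is unspecified on singular matrices; only inverses of nonsingular Gram matrices
  are ever used.\<close>

definition inv_mat :: "real Matrix.mat \<Rightarrow> real Matrix.mat" where
  "inv_mat B = the (mat_inverse B)"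

definition gram :: "real Matrix.mat \<Rightarrow> real Matrix.mat" where
  "gram Z = transpose_mat Z * Z"

definition proj_mat :: "real Matrix.mat \<Rightarrow> real Matrix.mat" where
  "proj_mat Z = Z * inv_mat (gram Z) * transpose_mat Z"

definition ols :: "real Matrix.mat \<Rightarrow> real Matrix.vec \<Rightarrow> real Matrix.vec" where
  "ols Z y = (inv_mat (gram Z) * transpose_mat Z) *\<^sub>v y"

definition rss :: "real Matrix.mat \<Rightarrow> real Matrix.vec \<Rightarrow> real" where
  "rss Z y = sq_norm (y - Z *\<^sub>v ols Z y)"

text \<open>The submatrix \<open>X(\<alpha>)\<close>, and the submatrix \<open>X\<^sub>i(\<alpha>)\<close> of its rows in a training sample \<open>I\<close>.\<close>

definition design :: "real Matrix.mat \<Rightarrow> nat set \<Rightarrow> real Matrix.mat" where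
  "design X \<alpha> = submatrix X UNIV \<alpha>"

definition train_design :: "real Matrix.mat \<Rightarrow> nat set \<Rightarrow> nat set \<Rightarrow> real Matrix.mat" where
  "train_design X I \<alpha> = submatrix X I \<alpha>"

text \<open>Entries are enumerated increasingly by \<^const>\<open>pick\<close>, exactly as \<^const>\<open>submatrix\<close> does for
  rows, so that \<open>subvec y I\<close> and \<open>train_design X I \<alpha>\<close> are aligned.\<close>

definition subvec :: "real Matrix.vec \<Rightarrow> nat set \<Rightarrow> real Matrix.vec" where
  "subvec v I = Matrix.vec (card {j. j < dim_vec v \<and> j \<in> I}) (\<lambda>j. vec_index v (pick I j))"

definition err_vec :: "(nat \<Rightarrow> 'a \<Rightarrow> real) \<Rightarrow> nat \<Rightarrow> 'a \<Rightarrow> real Matrix.vec" where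
  "err_vec e n \<omega> = Matrix.vec n (\<lambda>j. e j \<omega>)"

definition loss :: "nat \<Rightarrow> real Matrix.mat \<Rightarrow> real Matrix.vec \<Rightarrow> real Matrix.vec \<Rightarrow> nat set \<Rightarrow> real" where
  "loss n X \<mu> y \<alpha> = sq_norm (\<mu> - proj_mat (design X \<alpha>) *\<^sub>v y) / real n"

definition risk ::
  "'a measure \<Rightarrow> (nat \<Rightarrow> 'a \<Rightarrow> real) \<Rightarrow> nat \<Rightarrow> real Matrix.mat \<Rightarrow> real Matrix.vec \<Rightarrow> nat set \<Rightarrow> real" where
  "risk M e n X \<mu> \<alpha> = integral\<^sup>L M (\<lambda>\<omega>. loss n X \<mu> (\<mu> + err_vec e n \<omega>) \<alpha>)"

text \<open>The criterion, with error variance \<open>v\<close> and training samples \<open>T 0, \<dots>, T (r - 1)\<close>.\<close>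

definition crit ::
  "nat \<Rightarrow> real \<Rightarrow> real Matrix.mat \<Rightarrow> nat \<Rightarrow> (nat \<Rightarrow> nat set) \<Rightarrow> real Matrix.vec \<Rightarrow> nat set \<Rightarrow> real" where
  "crit n v X r T y \<alpha> =
     rss (design X \<alpha>) y / real n
     - (\<Sum>i<r. rss (train_design X (T i) \<alpha>) (subvec y (T i)) / real n) / real r
     + (\<Sum>i<r. v / real n *
          ln (Determinant.det (gram (design X \<alpha>)) /
              Determinant.det (gram (train_design X (T i) \<alpha>)))) / real r"

definition a_coef :: "nat \<Rightarrow> nat \<Rightarrow> real Matrix.mat \<Rightarrow> nat set \<Rightarrow> nat set \<Rightarrow> real" where
  "a_coef n k X I \<alpha> =
     ln (real (n - k) ^ card \<alpha> * Determinant.det (gram (design X \<alpha>)) /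
         (real n ^ card \<alpha> * Determinant.det (gram (train_design X I \<alpha>))))"

text \<open>
  Convergence in probability to a constant.  Measurability is part of the definition because
  \<^const>\<open>measure\<close> is 0 on nonmeasurable sets; it is required only from some index on, since the
  first few terms of the sequences of interest are not defined in the mathematics.
\<close>

definition tendsto_in_prob :: "'a measure \<Rightarrow> (nat \<Rightarrow> 'a \<Rightarrow> real) \<Rightarrow> real \<Rightarrow> bool" where
  "tendsto_in_prob M Z c \<longleftrightarrow>
     (\<forall>\<^sub>F n in sequentially. Z n \<in> borel_measurable M) \<and>
     (\<forall>\<epsilon>>0. (\<lambda>n. measure M {\<omega> \<in> space M. \<bar>Z n \<omega> - c\<bar> > \<epsilon>}) \<longlonglongrightarrow> 0)"

end

theory Submission
  imports Defs
begin

text \<open>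
  Write \<open>D\<close> for the minimal value of \<open>n R\<^sub>n(\<alpha>)\<close> over the candidate models and \<open>\<lambda>\<close> for
  \<open>log (n / (n - k))\<close>.  Since \<open>(n - k) / n\<close> tends to 0, \<open>\<lambda>\<close> tends to infinity, so (ii) forces
  \<open>p / D\<close> to tend to 0: the risk is dominated by the squared bias, uniformly in \<open>\<alpha>\<close>.
  Uniformity in \<open>\<alpha>\<close> then needs no union bound: all noise terms are
  controlled by the projection of the errors onto the span of \<^emph>\<open>all\<close>
  columns of the design (expected energy at most \<open>\<sigma>\<^sup>2 p\<close>) and by a scalar product of the errors
  with the part of the mean orthogonal to that span (variance at most \<open>\<sigma>\<^sup>2 D\<close>).
  The average residual sum of squares over the training samples is bounded above by inserting the
  least squares coefficients of the full-sample mean, where the balance condition turns the average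
  into the fraction \<open>(n - k) / n\<close> of a full sum, and below by replacing \<open>X\<^sub>i(\<alpha>)\<close> by the span of
  all columns.  The determinant term is nonnegative, because Gram determinants grow with
  the set of rows, and (ii) and (iii) bound it from above.
  Markov's inequality for a single random variable independent of \<open>\<alpha>\<close> finishes (a), and (b)
  is a deterministic consequence of (a).
\<close>

section \<open>Inner products over a finite index set\<close>

text \<open>Vectors are functions of a row index and the set \<open>I\<close> carries the summation,
  so a column is restricted to a training sample by changing \<open>I\<close> alone, without
  reindexing.\<close>

definition ip :: "'i set \<Rightarrow> ('i \<Rightarrow> real) \<Rightarrow> ('i \<Rightarrow> real) \<Rightarrow> real" where
  "ip I u v = (\<Sum>j\<in>I. u j * v j)"

lemma ip_commute: "ip I u v = ip I v u"
  by (simp add: ip_def mult.commute)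

lemma ip_cong: "(\<And>j. j \<in> I \<Longrightarrow> u j = u' j) \<Longrightarrow> (\<And>j. j \<in> I \<Longrightarrow> v j = v' j) \<Longrightarrow> ip I u v = ip I u' v'"
  unfolding ip_def by (rule sum.cong) auto

lemma ip_add_left: "ip I (\<lambda>j. u j + v j) w = ip I u w + ip I v w"
  by (simp add: ip_def sum.distrib distrib_right)

lemma ip_diff_left: "ip I (\<lambda>j. u j - v j) w = ip I u w - ip I v w"
  by (simp add: ip_def sum_subtractf left_diff_distrib)

lemma ip_scale_left: "ip I (\<lambda>j. c * u j) w = c * ip I u w"
  by (simp add: ip_def sum_distrib_left mult.assoc)

lemma ip_sum_left: "ip I (\<lambda>j. \<Sum>a\<in>K. u a j) w = (\<Sum>a\<in>K. ip I (u a) w)"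
  unfolding ip_def sum_distrib_right by (rule sum.swap)

lemma ip_add_right: "ip I w (\<lambda>j. u j + v j) = ip I w u + ip I w v"
  by (simp add: ip_commute[of I w] ip_add_left)

lemma ip_diff_right: "ip I w (\<lambda>j. u j - v j) = ip I w u - ip I w v"
  by (simp add: ip_commute[of I w] ip_diff_left)

lemma ip_scale_right: "ip I w (\<lambda>j. c * u j) = c * ip I w u"
  by (simp add: ip_commute[of I w] ip_scale_left)

lemma ip_sum_right: "ip I w (\<lambda>j. \<Sum>a\<in>K. u a j) = (\<Sum>a\<in>K. ip I w (u a))"
  by (simp add: ip_commute[of I w] ip_sum_left)

lemmas ip_simps = ip_add_left ip_diff_left ip_scale_left ip_sum_left
  ip_add_right ip_diff_right ip_scale_right ip_sum_right

lemma ip_self_nonneg: "0 \<le> ip I u u"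
  by (simp add: ip_def sum_nonneg)

lemma ip_self_eq_0: "finite I \<Longrightarrow> ip I u u = 0 \<longleftrightarrow> (\<forall>j\<in>I. u j = 0)"
  by (simp add: ip_def sum_nonneg_eq_0_iff)

lemma ip_self_mono: "finite J \<Longrightarrow> I \<subseteq> J \<Longrightarrow> ip I u u \<le> ip J u u"
  unfolding ip_def by (rule sum_mono2) auto

section \<open>Orthonormal families, projections and residuals\<close>

definition orthonormal :: "'i set \<Rightarrow> nat \<Rightarrow> (nat \<Rightarrow> 'i \<Rightarrow> real) \<Rightarrow> bool" where
  "orthonormal I d q \<longleftrightarrow> (\<forall>a<d. \<forall>b<d. ip I (q a) (q b) = (if a = b then 1 else 0))"

definition orth_proj :: "'i set \<Rightarrow> nat \<Rightarrow> (nat \<Rightarrow> 'i \<Rightarrow> real) \<Rightarrow> ('i \<Rightarrow> real) \<Rightarrow> 'i \<Rightarrow> real" where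
  "orth_proj I d q v j = (\<Sum>a<d. ip I (q a) v * q a j)"

definition orth_res :: "'i set \<Rightarrow> nat \<Rightarrow> (nat \<Rightarrow> 'i \<Rightarrow> real) \<Rightarrow> ('i \<Rightarrow> real) \<Rightarrow> 'i \<Rightarrow> real" where
  "orth_res I d q v j = v j - orth_proj I d q v j"

text \<open>The squared norm of \<open>orth_proj I d q v\<close> when \<open>q\<close> is
  orthonormal on \<open>I\<close>.\<close>

definition proj_energy :: "'i set \<Rightarrow> nat \<Rightarrow> (nat \<Rightarrow> 'i \<Rightarrow> real) \<Rightarrow> ('i \<Rightarrow> real) \<Rightarrow> real" where
  "proj_energy I d q v = (\<Sum>a<d. (ip I (q a) v)\<^sup>2)"

lemma proj_energy_nonneg: "0 \<le> proj_energy I d q v"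
  by (simp add: proj_energy_def sum_nonneg)

lemma ip_orth_proj: "ip I w (orth_proj I d q v) = (\<Sum>a<d. ip I (q a) v * ip I (q a) w)"
  unfolding orth_proj_def ip_simps by (simp add: ip_commute)

lemma ip_orth_res: "ip I w (orth_res I d q v) = ip I w v - (\<Sum>a<d. ip I (q a) v * ip I (q a) w)"
  unfolding orth_res_def ip_simps ip_orth_proj ..

lemma ip_basis_orth_proj:
  assumes "orthonormal I d q" "a < d"
  shows "ip I (q a) (orth_proj I d q v) = ip I (q a) v"
proof -
  have "ip I (q a) (orth_proj I d q v) = (\<Sum>b<d. ip I (q b) v * ip I (q b) (q a))"
    by (rule ip_orth_proj)
  also have "\<dots> = (\<Sum>b<d. if b = a then ip I (q a) v else 0)"
    using assms by (intro sum.cong) (auto simp: orthonormal_def)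
  finally show ?thesis using assms by simp
qed

lemma ip_basis_orth_res:
  assumes "orthonormal I d q" "a < d"
  shows "ip I (q a) (orth_res I d q v) = 0"
  unfolding orth_res_def ip_simps ip_basis_orth_proj[OF assms] by simp

lemma ip_self_orth_res:
  assumes "orthonormal I d q"
  shows "ip I (orth_res I d q v) (orth_res I d q v) = ip I v v - proj_energy I d q v"
proof -
  have "ip I (orth_res I d q v) (orth_res I d q v) = ip I v (orth_res I d q v)"
    unfolding ip_orth_res[of I "orth_res I d q v"]
    by (simp add: ip_basis_orth_res[OF assms] ip_commute)
  then show ?thesis
    by (simp add: ip_orth_res proj_energy_def power2_eq_square)
qed

lemma bessel: "orthonormal I d q \<Longrightarrow> proj_energy I d q v \<le> ip I v v"
  using ip_self_orth_res[of I d q v] ip_self_nonneg[of I "orth_res I d q v"] by simp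

lemma ip_orth_res_le: "orthonormal I d q \<Longrightarrow> ip I (orth_res I d q v) (orth_res I d q v) \<le> ip I v v"
  by (simp add: ip_self_orth_res proj_energy_nonneg)

text \<open>Gram-Schmidt by induction on \<open>p\<close>. A function already in the span on
  \<open>I\<close> adds no basis vector, so dependent families are allowed and \<open>d\<close> may
  be smaller than \<open>p\<close>.\<close>

lemma orthonormal_basis_exists:
  fixes x :: "nat \<Rightarrow> 'i \<Rightarrow> real"
  assumes "finite I"
  shows "\<exists>d q. d \<le> p \<and> orthonormal I d q \<and> (\<forall>c<p. \<forall>j\<in>I. orth_proj I d q (x c) j = x c j)"
proof (induction p)
  case 0
  show ?case by (intro exI[of _ 0]) (simp add: orthonormal_def)
next
  case (Suc p)
  then obtain d q where d: "d \<le> p" and on: "orthonormal I d q"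
    and sp: "\<And>c j. c < p \<Longrightarrow> j \<in> I \<Longrightarrow> orth_proj I d q (x c) j = x c j" by blast
  define z where "z = orth_res I d q (x p)"
  show ?case
  proof (cases "ip I z z = 0")
    case True
    then have "\<And>j. j \<in> I \<Longrightarrow> orth_proj I d q (x p) j = x p j"
      using ip_self_eq_0[OF assms, of z] by (simp add: z_def orth_res_def)
    with d on sp show ?thesis by (intro exI[of _ d] exI[of _ q]) (auto simp: less_Suc_eq)
  next
    case False
    define s where "s = 1 / sqrt (ip I z z)"
    have s: "s * (s * ip I z z) = 1"
      using False ip_self_nonneg[of I z] by (simp add: s_def)
    define q' where "q' = q(d := (\<lambda>j. s * z j))"
    have zq: "ip I (q a) z = 0" if "a < d" for a using ip_basis_orth_res[OF on that] by (simp add: z_def)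
    have on': "orthonormal I (Suc d) q'"
      using on s zq zq[unfolded ip_commute[of I "q _" z]] unfolding orthonormal_def q'_def
      by (auto simp: less_Suc_eq ip_scale_left ip_scale_right)
    have pr': "orth_proj I (Suc d) q' v j = orth_proj I d q v j + s * (s * ip I z v) * z j" for v j
      unfolding orth_proj_def by (auto simp: q'_def ip_scale_left intro!: sum.cong)
    \<comment> \<open>\<open>z\<close> is orthogonal to the old span, which contains each earlier
      \<open>x c\<close> on \<open>I\<close>, so the extra term in \<open>pr'\<close> vanishes for
      them.\<close>
    have zx: "ip I z (x c) = 0" if "c < p" for c
    proof -
      have "ip I z (x c) = ip I z (orth_proj I d q (x c))"
        using sp[OF that] by (intro ip_cong) auto
      then show ?thesis by (simp add: ip_orth_proj zq)
    qed
    have "ip I (x p) z = ip I z z"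
      unfolding z_def ip_self_orth_res[OF on] by (simp add: ip_orth_res proj_energy_def power2_eq_square)
    then have zz: "ip I z (x p) = ip I z z" by (simp only: ip_commute[of I z "x p"])
    have "orth_proj I (Suc d) q' (x c) j = x c j" if "c < Suc p" "j \<in> I" for c j
    proof (cases "c < p")
      case True
      then show ?thesis using sp that zx by (simp add: pr')
    next
      case False
      then have "c = p" using that by simp
      then show ?thesis using s unfolding pr' by (simp add: zz) (simp add: z_def orth_res_def)
    qed
    with d on' show ?thesis by (intro exI[of _ "Suc d"] exI[of _ q']) auto
  qed
qed

lemma orth_proj_lin_comb:
  assumes "\<And>c j. c \<in> C \<Longrightarrow> j \<in> I \<Longrightarrow> orth_proj I d q (x c) j = x c j" "j \<in> I"
  shows "orth_proj I d q (\<lambda>j. \<Sum>c\<in>C. b c * x c j) j = (\<Sum>c\<in>C. b c * x c j)"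
proof -
  have "orth_proj I d q (\<lambda>j. \<Sum>c\<in>C. b c * x c j) j = (\<Sum>a<d. \<Sum>c\<in>C. b c * (ip I (q a) (x c) * q a j))"
    by (simp add: orth_proj_def ip_simps sum_distrib_right mult.assoc)
  also have "\<dots> = (\<Sum>c\<in>C. b c * orth_proj I d q (x c) j)"
    unfolding orth_proj_def sum_distrib_left by (rule sum.swap)
  finally show ?thesis using assms by simp
qed

lemma orth_res_diff_fixed:
  assumes "\<And>j. j \<in> I \<Longrightarrow> orth_proj I d q g j = g j" "j \<in> I"
  shows "orth_res I d q (\<lambda>j. v j - g j) j = orth_res I d q v j"
  using assms
  by (simp add: orth_res_def orth_proj_def ip_simps left_diff_distrib sum_subtractf)

text \<open>Expand the square. Inside the span, completing the square bounds the contribution of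
  \<open>w\<close> from below by minus the energy of \<open>v\<close>; outside the span the square
  of \<open>w\<close> is dropped. What remains depends on \<open>w\<close> only through its
  residual.\<close>

lemma sq_dist_lower_bound:
  assumes on: "orthonormal I d q"
  shows "ip I (\<lambda>j. w j + v j) (\<lambda>j. w j + v j)
    \<ge> ip I v v - proj_energy I d q v + 2 * ip I v (orth_res I d q w)"
proof -
  have "0 \<le> (\<Sum>a<d. (ip I (q a) w + ip I (q a) v)\<^sup>2)" by (simp add: sum_nonneg)
  also have "\<dots> = proj_energy I d q w + proj_energy I d q v + 2 * (\<Sum>a<d. ip I (q a) w * ip I (q a) v)"
    by (simp add: proj_energy_def power2_sum sum.distrib sum_distrib_left mult.assoc)
  finally show ?thesis using bessel[OF on, of w]
    unfolding ip_orth_res by (simp add: ip_simps ip_commute[of I v w])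
qed

text \<open>The difference is the inner product of the projections of \<open>v\<close> and
  \<open>w\<close>, so Cauchy-Schwarz for the coordinates and Bessel's inequality apply.\<close>

lemma ip_minus_res_bound:
  assumes on: "orthonormal I d q"
  shows "(ip I v w - ip I v (orth_res I d q w))\<^sup>2 \<le> ip I w w * proj_energy I d q v"
proof -
  have "(ip I v w - ip I v (orth_res I d q w))\<^sup>2 = (\<Sum>a<d. ip I (q a) w * ip I (q a) v)\<^sup>2"
    by (simp add: ip_orth_res)
  also have "\<dots> \<le> proj_energy I d q w * proj_energy I d q v"
    unfolding proj_energy_def by (rule Cauchy_Schwarz_ineq_sum)
  also have "\<dots> \<le> ip I w w * proj_energy I d q v"
    by (intro mult_right_mono bessel on proj_energy_nonneg)
  finally show ?thesis .
qed

text \<open>Since \<open>h\<close> has no residual, \<open>ip_minus_res_bound\<close> bounds the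
  square of \<open>ip I h h\<close> by \<open>ip I h h\<close> times the energy of \<open>v\<close>;
  one factor cancels.\<close>

lemma fit_energy_le:
  assumes on: "orthonormal I d q"
    and fixed: "\<And>j. j \<in> I \<Longrightarrow> orth_proj I d q h j = h j"
    and fit: "ip I h h = ip I v h"
  shows "ip I h h \<le> proj_energy I d q v"
proof -
  have "ip I v (orth_res I d q h) = 0"
    using fixed by (subst ip_cong[where u' = v and v' = "\<lambda>_. 0"]) (auto simp: orth_res_def ip_def)
  with ip_minus_res_bound[OF on, of v h] fit
  have "ip I h h * ip I h h \<le> ip I h h * proj_energy I d q v"
    by (simp add: power2_eq_square)
  then show ?thesis using ip_self_nonneg[of I h] proj_energy_nonneg[of I d q v]
    by (cases "ip I h h = 0") (auto simp: mult_le_cancel_left)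
qed

section \<open>Gram determinants\<close>

text \<open>Orthogonal projection onto the span of possibly dependent functions, with explicit
  coefficients. The induction hypothesis is applied to both \<open>x c\<close> and \<open>v\<close>;
  then the component along the residual of \<open>x c\<close> is removed from the residual of
  \<open>v\<close>.\<close>

lemma residual_exists:
  fixes x :: "nat \<Rightarrow> 'i \<Rightarrow> real"
  assumes "finite I"
  shows "\<exists>b. \<forall>a<c. ip I (\<lambda>j. v j - (\<Sum>a<c. b a * x a j)) (x a) = 0"
proof (induction c arbitrary: v)
  case 0
  show ?case by simp
next
  case (Suc c)
  obtain b where b: "\<And>a. a < c \<Longrightarrow> ip I (\<lambda>j. x c j - (\<Sum>a<c. b a * x a j)) (x a) = 0"
    using Suc.IH[of "x c"] by blast
  obtain b' where b': "\<And>a. a < c \<Longrightarrow> ip I (\<lambda>j. v j - (\<Sum>a<c. b' a * x a j)) (x a) = 0"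
    using Suc.IH[of v] by blast
  define z where "z = (\<lambda>j. x c j - (\<Sum>a<c. b a * x a j))"
  define w where "w = (\<lambda>j. v j - (\<Sum>a<c. b' a * x a j))"
  define t where "t = ip I w z / ip I z z"
  have zx: "ip I z (x a) = 0" and wx: "ip I w (x a) = 0" if "a < c" for a
    using b[OF that] b'[OF that] by (simp_all add: z_def w_def)
  have xc: "x c = (\<lambda>j. z j + (\<Sum>a<c. b a * x a j))" by (simp add: z_def)
  \<comment> \<open>If \<open>z\<close> vanishes on \<open>I\<close>, the quotient in
    \<open>t\<close> divides by zero, but then both sides are 0 whatever \<open>t\<close>
    is.\<close>
  have wz: "ip I w z = t * ip I z z"
  proof (cases "ip I z z = 0")
    case True
    then have "\<forall>j\<in>I. z j = 0" using ip_self_eq_0[OF assms] by blast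
    then have "ip I w z = 0" by (simp add: ip_def)
    then show ?thesis by (simp add: True)
  qed (simp add: t_def)
  have 1: "ip I (\<lambda>j. w j - t * z j) (x a) = 0" if "a < Suc c" for a
  proof (cases "a < c")
    case True
    then show ?thesis by (simp add: ip_simps zx wx)
  next
    case False
    then have a: "a = c" using that by simp
    have "ip I w (x c) = ip I w z" "ip I z (x c) = ip I z z"
      unfolding xc by (simp_all add: ip_simps zx wx)
    then show ?thesis by (simp add: a ip_simps wz)
  qed
  have 2: "w j - t * z j = v j - (\<Sum>a<Suc c. (if a < c then b' a - t * b a else t) * x a j)" for j
    unfolding w_def z_def
    by (simp add: left_diff_distrib right_diff_distrib sum_subtractf sum_distrib_left mult.assoc)
  show ?case
    by (rule exI[of _ "\<lambda>a. if a < c then b' a - t * b a else t"]) (use 1 in \<open>simp only: 2, blast\<close>)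
qed

definition gram_det :: "'i set \<Rightarrow> (nat \<Rightarrow> 'i \<Rightarrow> real) \<Rightarrow> nat \<Rightarrow> real" where
  "gram_det I x c = Determinant.det (Matrix.mat c c (\<lambda>(a, b). ip I (x a) (x b)))"

text \<open>Subtracting a combination of the earlier columns leaves the determinant unchanged, and
  an orthogonal residual makes the Gram matrix block triangular.\<close>

lemma gram_det_Suc:
  fixes x :: "nat \<Rightarrow> 'i \<Rightarrow> real"
  assumes orth: "\<And>a. a < c \<Longrightarrow> ip I (\<lambda>j. x c j - (\<Sum>a<c. b a * x a j)) (x a) = 0"
  defines "z \<equiv> \<lambda>j. x c j - (\<Sum>a<c. b a * x a j)"
  shows "gram_det I x (Suc c) = gram_det I x c * ip I z z"
proof -
  let ?G = "Matrix.mat (Suc c) (Suc c) (\<lambda>(a, b). ip I (x a) (x b))"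
  let ?U = "Matrix.mat (Suc c) (Suc c) (\<lambda>(i, j). if i = j then 1 else if j = c then - b i else 0)"
  have U: "?U \<in> carrier_mat (Suc c) (Suc c)" and G: "?G \<in> carrier_mat (Suc c) (Suc c)" by auto
  have "Determinant.det ?U = prod_list (diag_mat ?U)"
    by (rule det_upper_triangular[OF _ U]) (auto simp: upper_triangular_def)
  also have "diag_mat ?U = map (\<lambda>_. 1) [0..<Suc c]"
    unfolding diag_mat_def by (rule map_cong) (auto simp del: upt_Suc)
  also have "prod_list \<dots> = (1::real)" by (induction c) auto
  finally have detU: "Determinant.det ?U = 1" .
  have zx: "ip I z (x a) = 0" if "a < c" for a using orth[OF that] by (simp add: z_def)
  have zxc: "ip I z (x c) = ip I z z"
  proof -
    have "x c = (\<lambda>j. z j + (\<Sum>a<c. b a * x a j))" by (simp add: z_def)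
    then have "ip I z (x c) = ip I z (\<lambda>j. z j + (\<Sum>a<c. b a * x a j))" by simp
    then show ?thesis by (simp add: ip_simps zx)
  qed
  have entry: "(?G * ?U) $$ (i, j) = (if j = c then (if i = c then ip I z z else 0) else ip I (x i) (x j))"
    if "i < Suc c" "j < Suc c" for i j
  proof -
    have "(?G * ?U) $$ (i, j) = (\<Sum>l<Suc c. ip I (x i) (x l) * (if l = j then 1 else if j = c then - b l else 0))"
      using that by (simp add: scalar_prod_def atLeast0LessThan)
    also have "\<dots> = (if j = c then ip I (x i) z else ip I (x i) (x j))"
    proof (cases "j = c")
      case True
      have "ip I (x i) z = ip I (x i) (x c) - (\<Sum>a<c. b a * ip I (x i) (x a))"
        by (simp add: z_def ip_simps)
      then show ?thesis using True by (simp add: sum_negf mult.commute)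
    next
      case False
      then show ?thesis using that by (simp add: sum.delta if_distrib[of "\<lambda>y. _ * y"] cong: if_cong)
    qed
    also have "ip I (x i) z = (if i = c then ip I z z else 0)"
      using that zx[of i] zxc by (auto simp: ip_commute[of I "x i"] less_Suc_eq)
    finally show ?thesis .
  qed
  have GU: "?G * ?U \<in> carrier_mat (Suc c) (Suc c)" by (rule mult_carrier_mat[OF G U])
  have del: "mat_delete (?G * ?U) c c = Matrix.mat c c (\<lambda>(a, b). ip I (x a) (x b))"
  proof (rule eq_matI)
    fix i j
    assume "i < dim_row (Matrix.mat c c (\<lambda>(a, b). ip I (x a) (x b)))"
      and "j < dim_col (Matrix.mat c c (\<lambda>(a, b). ip I (x a) (x b)))"
    then have ij: "i < c" "j < c" by auto
    then have "mat_delete (?G * ?U) c c $$ (i, j) = (?G * ?U) $$ (i, j)"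
      by (simp add: mat_delete_def del: index_mult_mat(1))
    with entry[of i j] ij show "mat_delete (?G * ?U) c c $$ (i, j)
        = Matrix.mat c c (\<lambda>(a, b). ip I (x a) (x b)) $$ (i, j)" by simp
  qed (auto simp: mat_delete_def)
  have "Determinant.det ?G = Determinant.det (?G * ?U)"
    by (simp add: det_mult[OF G U] detU)
  \<comment> \<open>Only the diagonal entry of the last column survives, so the expansion has a
    single term, with minor \<open>gram_det I x c\<close>.\<close>
  also have "\<dots> = (\<Sum>i<Suc c. (?G * ?U) $$ (i, c) * cofactor (?G * ?U) i c)"
    by (rule laplace_expansion_column[OF GU]) simp
  also have "\<dots> = (\<Sum>i<Suc c. if i = c then ip I z z * cofactor (?G * ?U) c c else 0)"
    by (intro sum.cong) (simp_all add: entry del: index_mult_mat(1))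
  also have "\<dots> = ip I z z * gram_det I x c"
    by (simp add: cofactor_def del gram_det_def)
  finally show ?thesis by (simp add: gram_det_def)
qed

text \<open>By \<open>gram_det_Suc\<close> each new function multiplies the determinant by its
  squared distance from the span of the earlier ones. The distance over \<open>I\<close> is at most
  the norm over \<open>I\<close> of the residual optimal for \<open>J\<close>, hence at most its
  norm over \<open>J\<close>.\<close>

lemma gram_det_mono:
  assumes "finite J" "I \<subseteq> J"
  shows "0 \<le> gram_det I x c \<and> gram_det I x c \<le> gram_det J x c"
proof (induction c)
  case 0
  show ?case by (simp add: gram_det_def)
next
  case (Suc c)
  have fI: "finite I" using assms finite_subset by blast
  obtain b where b: "\<And>a. a < c \<Longrightarrow> ip I (\<lambda>j. x c j - (\<Sum>a<c. b a * x a j)) (x a) = 0"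
    using residual_exists[OF fI] by blast
  obtain b' where b': "\<And>a. a < c \<Longrightarrow> ip J (\<lambda>j. x c j - (\<Sum>a<c. b' a * x a j)) (x a) = 0"
    using residual_exists[OF assms(1)] by blast
  define z where "z = (\<lambda>j. x c j - (\<Sum>a<c. b a * x a j))"
  define z' where "z' = (\<lambda>j. x c j - (\<Sum>a<c. b' a * x a j))"
  have zx: "ip I z (x a) = 0" if "a < c" for a using b[OF that] by (simp add: z_def)
  \<comment> \<open>\<open>z'\<close> differs from \<open>z\<close> by a combination orthogonal to
    \<open>z\<close> over \<open>I\<close>, so Pythagoras gives the comparison.\<close>
  have z': "z' = (\<lambda>j. z j + (\<Sum>a<c. (b a - b' a) * x a j))"
    by (simp add: z'_def z_def fun_eq_iff algebra_simps sum_subtractf)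
  have "ip I z (\<lambda>j. \<Sum>a<c. (b a - b' a) * x a j) = 0"
    by (simp only: ip_simps) (simp add: zx)
  then have "ip I z z \<le> ip I z' z'"
    using ip_self_nonneg[of I "\<lambda>j. \<Sum>a<c. (b a - b' a) * x a j"]
      ip_commute[of I z "\<lambda>j. \<Sum>a<c. (b a - b' a) * x a j"]
    unfolding z' ip_add_left ip_add_right by linarith
  also have "\<dots> \<le> ip J z' z'" by (rule ip_self_mono) fact+
  finally have "ip I z z \<le> ip J z' z'" .
  moreover have "gram_det I x (Suc c) = gram_det I x c * ip I z z"
    unfolding z_def by (rule gram_det_Suc) (rule b)
  moreover have "gram_det J x (Suc c) = gram_det J x c * ip J z' z'"
    unfolding z'_def by (rule gram_det_Suc) (rule b')
  ultimately show ?case using Suc.IH ip_self_nonneg[of I z] by (simp add: mult_mono)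
qed

section \<open>Least squares fits\<close>

lemma bij_betw_pick: "finite I \<Longrightarrow> bij_betw (pick I) {..<card I} I"
proof -
  assume fin: "finite I"
  have inj: "inj_on (pick I) {..<card I}"
    by (rule linorder_inj_onI) (use pick_mono_le in \<open>fastforce\<close>)+
  have "pick I ` {..<card I} \<subseteq> I" using pick_in_set_le by auto
  then have "pick I ` {..<card I} = I"
    using card_image[OF inj] fin by (intro card_subset_eq) auto
  with inj show ?thesis by (simp add: bij_betw_def)
qed

lemma sum_pick: "finite I \<Longrightarrow> (\<Sum>a<card I. f (pick I a)) = (\<Sum>j\<in>I. f j)"
  by (rule sum.reindex_bij_betw[OF bij_betw_pick])

lemma pick_lessThan: "i < n \<Longrightarrow> pick {..<n} i = i"
  using pick_reduce_set[of i n UNIV] by (simp add: pick_UNIV lessThan_def)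

lemma train_design_eq:
  assumes "X \<in> carrier_mat n p" "I \<subseteq> {..<n}" "\<alpha> \<subseteq> {..<p}"
  shows "train_design X I \<alpha> = Matrix.mat (card I) (card \<alpha>) (\<lambda>(i, a). X $$ (pick I i, pick \<alpha> a))"
proof -
  have "{i. i < n \<and> i \<in> I} = I" "{j. j < p \<and> j \<in> \<alpha>} = \<alpha>" using assms by auto
  then show ?thesis using assms by (simp add: train_design_def submatrix_def)
qed

text \<open>Through this identity every fact about row subsets also covers the full sample.\<close>

lemma design_eq:
  assumes "X \<in> carrier_mat n p" "\<alpha> \<subseteq> {..<p}"
  shows "design X \<alpha> = train_design X {..<n} \<alpha>"
proof -
  have "{j. j < p \<and> j \<in> \<alpha>} = \<alpha>" using assms by auto
  then show ?thesis unfolding train_design_eq[OF assms(1) subset_refl assms(2)]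
    using assms by (intro eq_matI) (auto simp: design_def submatrix_def pick_UNIV pick_lessThan)
qed

lemma subvec_eq:
  assumes "v \<in> carrier_vec n" "I \<subseteq> {..<n}"
  shows "subvec v I = Matrix.vec (card I) (\<lambda>i. vec_index v (pick I i))"
proof -
  have "{i. i < n \<and> i \<in> I} = I" using assms by auto
  then show ?thesis using assms by (simp add: subvec_def)
qed

lemma subvec_index:
  "v \<in> carrier_vec n \<Longrightarrow> I \<subseteq> {..<n} \<Longrightarrow> i < card I \<Longrightarrow> vec_index (subvec v I) i = vec_index v (pick I i)"
  by (simp add: subvec_eq)

lemma subvec_lessThan: "v \<in> carrier_vec n \<Longrightarrow> subvec v {..<n} = v"
  by (intro eq_vecI) (auto simp: subvec_eq pick_lessThan)

lemma subvec_add: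
  assumes "u \<in> carrier_vec n" "v \<in> carrier_vec n" "I \<subseteq> {..<n}"
  shows "subvec (u + v) I = subvec u I + subvec v I"
proof -
  have "pick I i < n" if "i < card I" for i
    using pick_in_set_le[OF that] assms(3) by auto
  then show ?thesis
    unfolding subvec_eq[OF add_carrier_vec[OF assms(1,2)] assms(3)] subvec_eq[OF assms(1,3)] subvec_eq[OF assms(2,3)]
    using assms by (intro eq_vecI) auto
qed

lemma sq_norm_vec: "sq_norm v = (\<Sum>i<dim_vec v. (vec_index v i)\<^sup>2)"
  by (simp add: sq_norm_def scalar_prod_def power2_eq_square atLeast0LessThan)

lemma sq_norm_err_vec: "sq_norm (err_vec e n \<omega>) = ip {..<n} (\<lambda>j. e j \<omega>) (\<lambda>j. e j \<omega>)"
  by (simp add: sq_norm_vec err_vec_def ip_def power2_eq_square)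

lemma gram_train_design:
  assumes "X \<in> carrier_mat n p" "I \<subseteq> {..<n}" "\<alpha> \<subseteq> {..<p}"
  shows "gram (train_design X I \<alpha>) = Matrix.mat (card \<alpha>) (card \<alpha>)
    (\<lambda>(a, b). ip I (\<lambda>j. X $$ (j, pick \<alpha> a)) (\<lambda>j. X $$ (j, pick \<alpha> b)))"
proof -
  have "finite I" using assms finite_subset by blast
  then have *: "ip I u v = (\<Sum>i<card I. u (pick I i) * v (pick I i))" for u v :: "nat \<Rightarrow> real"
    unfolding ip_def by (rule sum_pick[symmetric])
  show ?thesis unfolding gram_def train_design_eq[OF assms] *
    by (intro eq_matI) (auto simp: scalar_prod_def atLeast0LessThan)
qed

lemma det_gram_train_design:
  assumes "X \<in> carrier_mat n p" "I \<subseteq> {..<n}" "\<alpha> \<subseteq> {..<p}"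
  shows "Determinant.det (gram (train_design X I \<alpha>)) = gram_det I (\<lambda>a j. X $$ (j, pick \<alpha> a)) (card \<alpha>)"
  unfolding gram_train_design[OF assms] gram_det_def ..

section \<open>Inverse Gram matrices and the normal equations\<close>

lemma invertible_mat_det_nonzero:
  fixes B :: "'a :: field Matrix.mat"
  assumes B: "B \<in> carrier_mat c c" and inv: "invertible_mat B"
  shows "Determinant.det B \<noteq> 0"
proof -
  obtain C where BC: "B * C = 1\<^sub>m c" and CB: "C * B = 1\<^sub>m (dim_row C)"
    using B inv by (auto simp: invertible_mat_def inverts_mat_def)
  have "dim_col C = c" using arg_cong[OF BC, of dim_col] by simp
  moreover have "dim_row C = c" using arg_cong[OF CB, of dim_col] B by simp
  ultimately have C: "C \<in> carrier_mat c c" by auto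
  show ?thesis using arg_cong[OF BC, of Determinant.det] det_mult[OF B C] by auto
qed

text \<open>A nonzero determinant makes \<open>B\<close> a unit, which rules out the result
  \<open>None\<close>, so the \<open>the\<close> in \<open>inv_mat\<close> is applied to a genuine
  inverse.\<close>

lemma inv_mat:
  assumes B: "B \<in> carrier_mat c c" and nz: "Determinant.det B \<noteq> 0"
  shows "B * inv_mat B = 1\<^sub>m c" "inv_mat B * B = 1\<^sub>m c" "inv_mat B \<in> carrier_mat c c"
proof -
  have "mat_inverse B \<noteq> None"
    using mat_inverse(1)[OF B, of "()"] det_non_zero_imp_unit[OF B nz, of "()"] by blast
  then obtain C where C: "mat_inverse B = Some C" by blast
  show "B * inv_mat B = 1\<^sub>m c" "inv_mat B * B = 1\<^sub>m c" "inv_mat B \<in> carrier_mat c c"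
    using mat_inverse(2)[OF B C] by (simp_all add: inv_mat_def C)
qed

lemma gram_carrier: "Z \<in> carrier_mat N c \<Longrightarrow> gram Z \<in> carrier_mat c c"
  by (simp add: gram_def)

lemma ols_carrier:
  assumes "Z \<in> carrier_mat N c" "Determinant.det (gram Z) \<noteq> 0"
  shows "ols Z y \<in> carrier_vec c"
  using carrier_matD(1)[OF inv_mat(3)[OF gram_carrier[OF assms(1)] assms(2)]]
  by (intro carrier_vecI) (simp add: ols_def)

lemma normal_equations:
  assumes Z: "Z \<in> carrier_mat N c" and nz: "Determinant.det (gram Z) \<noteq> 0" and y: "y \<in> carrier_vec N"
  shows "transpose_mat Z *\<^sub>v (Z *\<^sub>v ols Z y) = transpose_mat Z *\<^sub>v y"
proof -
  note G = gram_carrier[OF Z] and inv = inv_mat[OF gram_carrier[OF Z] nz]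
  have Zt: "transpose_mat Z \<in> carrier_mat c N" using Z by simp
  have "transpose_mat Z *\<^sub>v (Z *\<^sub>v ols Z y) = gram Z *\<^sub>v ols Z y"
    unfolding gram_def by (rule assoc_mult_mat_vec[symmetric, OF Zt Z ols_carrier[OF Z nz]])
  also have "\<dots> = (gram Z * (inv_mat (gram Z) * transpose_mat Z)) *\<^sub>v y"
    unfolding ols_def by (rule assoc_mult_mat_vec[symmetric, OF G mult_carrier_mat[OF inv(3) Zt] y])
  also have "gram Z * (inv_mat (gram Z) * transpose_mat Z) = transpose_mat Z"
    using assoc_mult_mat[OF G inv(3) Zt] inv(1) left_mult_one_mat[OF Zt] by simp
  finally show ?thesis .
qed

lemma ols_add:
  assumes Z: "Z \<in> carrier_mat N c" and nz: "Determinant.det (gram Z) \<noteq> 0"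
    and "u \<in> carrier_vec N" "v \<in> carrier_vec N"
  shows "ols Z (u + v) = ols Z u + ols Z v"
  unfolding ols_def using inv_mat(3)[OF gram_carrier[OF Z] nz] Z assms(3,4)
  by (intro mult_add_distrib_mat_vec[where nr=c and nc=N]) auto

lemma proj_mat_mult_vec:
  assumes Z: "Z \<in> carrier_mat N c" and nz: "Determinant.det (gram Z) \<noteq> 0" and y: "y \<in> carrier_vec N"
  shows "proj_mat Z *\<^sub>v y = Z *\<^sub>v ols Z y"
proof -
  note inv = inv_mat(3)[OF gram_carrier[OF Z] nz]
  have Zt: "transpose_mat Z \<in> carrier_mat c N" using Z by simp
  show ?thesis
    unfolding proj_mat_def ols_def assoc_mult_mat[OF Z inv Zt]
    by (rule assoc_mult_mat_vec[OF Z mult_carrier_mat[OF inv Zt] y])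
qed

text \<open>One setting for the full sample, with \<open>I\<close> the whole index range, and for
  each training sample.\<close>

locale subdesign =
  fixes X :: "real Matrix.mat" and n p :: nat and I \<alpha> :: "nat set"
  assumes X: "X \<in> carrier_mat n p" and I: "I \<subseteq> {..<n}" and \<alpha>: "\<alpha> \<subseteq> {..<p}"
    and det_nz: "Determinant.det (gram (train_design X I \<alpha>)) \<noteq> 0"
begin

text \<open>The coefficients come from the rows in \<open>I\<close>, but the fitted function is
  defined at every row, so a fit from one sample can be evaluated on another.\<close>

definition fit :: "real Matrix.vec \<Rightarrow> nat \<Rightarrow> real" where
  "fit y j = (\<Sum>a<card \<alpha>. vec_index (ols (train_design X I \<alpha>) (subvec y I)) a * X $$ (j, pick \<alpha> a))"

lemma finite_I: "finite I"
  using I finite_subset by blast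

lemma Z_carrier: "train_design X I \<alpha> \<in> carrier_mat (card I) (card \<alpha>)"
  by (simp add: train_design_eq[OF X I \<alpha>])

lemma subvec_carrier: "y \<in> carrier_vec n \<Longrightarrow> subvec y I \<in> carrier_vec (card I)"
  using I by (simp add: subvec_eq)

lemma train_design_mult_ols:
  assumes "i < card I"
  shows "vec_index (train_design X I \<alpha> *\<^sub>v ols (train_design X I \<alpha>) (subvec y I)) i = fit y (pick I i)"
proof -
  define b where "b = ols (train_design X I \<alpha>) (subvec y I)"
  have b: "dim_vec b = card \<alpha>" using ols_carrier[OF Z_carrier det_nz] by (auto simp: b_def)
  show ?thesis unfolding fit_def b_def[symmetric] using assms b
    by (simp add: train_design_eq[OF X I \<alpha>] scalar_prod_def atLeast0LessThan mult.commute)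
qed

lemma rss_eq:
  assumes "y \<in> carrier_vec n"
  shows "rss (train_design X I \<alpha>) (subvec y I)
    = ip I (\<lambda>j. vec_index y j - fit y j) (\<lambda>j. vec_index y j - fit y j)"
proof -
  have "rss (train_design X I \<alpha>) (subvec y I)
    = (\<Sum>i<card I. (vec_index y (pick I i) - fit y (pick I i))\<^sup>2)"
    unfolding rss_def sq_norm_vec using Z_carrier subvec_carrier[OF assms] I assms
    by (intro sum.cong) (auto simp: train_design_mult_ols subvec_index simp del: index_mult_mat_vec)
  also have "\<dots> = (\<Sum>j\<in>I. (vec_index y j - fit y j)\<^sup>2)"
    by (rule sum_pick[OF finite_I])
  finally show ?thesis by (simp add: ip_def power2_eq_square)
qed

text \<open>These are the normal equations read one component at a time, with the sum over
  enumerated rows turned into a sum over \<open>I\<close>.\<close>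

lemma fit_orth:
  assumes y: "y \<in> carrier_vec n" and a: "a < card \<alpha>"
  shows "ip I (\<lambda>j. vec_index y j - fit y j) (\<lambda>j. X $$ (j, pick \<alpha> a)) = 0"
proof -
  let ?Z = "train_design X I \<alpha>"
  have eq: "vec_index (transpose_mat ?Z *\<^sub>v w) a = (\<Sum>i<card I. vec_index w i * X $$ (pick I i, pick \<alpha> a))"
    if "w \<in> carrier_vec (card I)" for w
    using that a by (simp add: train_design_eq[OF X I \<alpha>] scalar_prod_def atLeast0LessThan mult.commute)
  have c: "?Z *\<^sub>v ols ?Z (subvec y I) \<in> carrier_vec (card I)"
    using Z_carrier by (auto intro!: mult_mat_vec_carrier ols_carrier det_nz)
  have "(\<Sum>j\<in>I. fit y j * X $$ (j, pick \<alpha> a)) = (\<Sum>j\<in>I. vec_index y j * X $$ (j, pick \<alpha> a))"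
    using arg_cong[OF normal_equations[OF Z_carrier det_nz subvec_carrier[OF y]], of "\<lambda>v. vec_index v a"]
    unfolding eq[OF c] eq[OF subvec_carrier[OF y]] sum_pick[OF finite_I, symmetric]
    by (simp add: train_design_mult_ols subvec_index[OF y I] del: index_mult_mat_vec)
  then show ?thesis by (simp add: ip_def left_diff_distrib sum_subtractf)
qed

lemma fit_orth_comb:
  assumes y: "y \<in> carrier_vec n"
  shows "ip I (\<lambda>j. vec_index y j - fit y j) (\<lambda>j. \<Sum>a<card \<alpha>. b a * X $$ (j, pick \<alpha> a)) = 0"
  unfolding ip_sum_right ip_scale_right by (simp add: fit_orth[OF y])

lemma fit_orth_fit:
  "y \<in> carrier_vec n \<Longrightarrow> ip I (\<lambda>j. vec_index y j - fit y j) (fit v) = 0"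
  unfolding fit_def[of v] by (rule fit_orth_comb)

text \<open>Pythagoras: the least squares residual is orthogonal to the difference between the fit
  and any other combination of the columns.\<close>

lemma rss_le:
  assumes y: "y \<in> carrier_vec n"
  shows "rss (train_design X I \<alpha>) (subvec y I) \<le>
    ip I (\<lambda>j. vec_index y j - (\<Sum>a<card \<alpha>. b a * X $$ (j, pick \<alpha> a)))
         (\<lambda>j. vec_index y j - (\<Sum>a<card \<alpha>. b a * X $$ (j, pick \<alpha> a)))"
proof -
  define u where "u = (\<lambda>j. vec_index y j - fit y j)"
  define g where "g = (\<lambda>j. \<Sum>a<card \<alpha>. (vec_index (ols (train_design X I \<alpha>) (subvec y I)) a - b a) * X $$ (j, pick \<alpha> a))"
  have "ip I u g = 0" unfolding u_def g_def by (rule fit_orth_comb[OF y])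
  moreover have "(\<lambda>j. vec_index y j - (\<Sum>a<card \<alpha>. b a * X $$ (j, pick \<alpha> a))) = (\<lambda>j. u j + g j)"
    by (simp add: u_def g_def fit_def left_diff_distrib sum_subtractf)
  moreover have "rss (train_design X I \<alpha>) (subvec y I) = ip I u u"
    unfolding u_def by (rule rss_eq[OF y])
  ultimately show ?thesis using ip_self_nonneg[of I g] ip_commute[of I g u]
    by (simp add: ip_add_left ip_add_right)
qed

lemma fit_add:
  assumes "u \<in> carrier_vec n" "v \<in> carrier_vec n"
  shows "fit (u + v) j = fit u j + fit v j"
proof -
  have "ols (train_design X I \<alpha>) (subvec (u + v) I)
    = ols (train_design X I \<alpha>) (subvec u I) + ols (train_design X I \<alpha>) (subvec v I)"
    using assms by (simp add: subvec_add[OF _ _ I] ols_add[OF Z_carrier det_nz] subvec_carrier)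
  then show ?thesis
    unfolding fit_def sum.distrib[symmetric]
    using carrier_vecD[OF ols_carrier[OF Z_carrier det_nz]]
    by (intro sum.cong) (auto simp: distrib_right)
qed

text \<open>The fit is linear in the observations, with a coefficient matrix \<open>B\<close> that
  is not random.\<close>

lemma fit_measurable:
  assumes v: "\<And>\<omega>. v \<omega> \<in> carrier_vec n"
    and meas: "\<And>i. i < n \<Longrightarrow> (\<lambda>\<omega>. vec_index (v \<omega>) i) \<in> borel_measurable M"
  shows "(\<lambda>\<omega>. fit (v \<omega>) j) \<in> borel_measurable M"
proof -
  let ?Z = "train_design X I \<alpha>"
  define B where "B = inv_mat (gram ?Z) * transpose_mat ?Z"
  have B: "B \<in> carrier_mat (card \<alpha>) (card I)"
    using inv_mat(3)[OF gram_carrier[OF Z_carrier] det_nz] Z_carrier by (auto simp: B_def)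
  have "vec_index (ols ?Z (subvec (v \<omega>) I)) a = (\<Sum>i<card I. B $$ (a, i) * vec_index (v \<omega>) (pick I i))"
    if "a < card \<alpha>" for a \<omega>
    using that B unfolding ols_def B_def[symmetric]
    by (simp add: scalar_prod_def atLeast0LessThan subvec_eq[OF v I])
  then have "fit (v \<omega>) j = (\<Sum>a<card \<alpha>. (\<Sum>i<card I. B $$ (a, i) * vec_index (v \<omega>) (pick I i)) * X $$ (j, pick \<alpha> a))" for \<omega>
    by (simp add: fit_def)
  moreover have "pick I i < n" if "i < card I" for i
    using pick_in_set_le[OF that] I by auto
  ultimately show ?thesis using meas by simp
qed

end

locale full_subdesign = subdesign X n p "{..<n}" \<alpha> for X n p \<alpha>
begin

lemma proj_mat_design:
  assumes y: "y \<in> carrier_vec n" and j: "j < n"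
  shows "vec_index (proj_mat (design X \<alpha>) *\<^sub>v y) j = fit y j"
  using proj_mat_mult_vec[OF Z_carrier det_nz] train_design_mult_ols[of j y] y j
  by (simp add: design_eq[OF X \<alpha>] subvec_lessThan pick_lessThan)

lemma loss_eq:
  assumes m: "m \<in> carrier_vec n" and y: "y \<in> carrier_vec n"
  shows "loss n X m y \<alpha> = ip {..<n} (\<lambda>j. vec_index m j - fit y j) (\<lambda>j. vec_index m j - fit y j) / real n"
proof -
  have "dim_vec (proj_mat (design X \<alpha>) *\<^sub>v y) = n"
    using Z_carrier by (simp add: proj_mat_def design_eq[OF X \<alpha>])
  then show ?thesis unfolding loss_def sq_norm_vec ip_def
    using m y by (simp add: proj_mat_design power2_eq_square del: index_mult_mat_vec)
qed

text \<open>Used contrapositively: for an incorrect model the mean differs somewhere from its own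
  fit, so the squared bias is positive.\<close>

lemma fit_in_col_space:
  assumes m: "m \<in> carrier_vec n" and eq: "\<And>j. j < n \<Longrightarrow> vec_index m j = fit m j"
  shows "m \<in> vec_space.col_space n (design X \<alpha>)"
proof -
  let ?Z = "train_design X {..<n} \<alpha>"
  have Z: "?Z \<in> carrier_mat n (card \<alpha>)" using Z_carrier by simp
  have "?Z *\<^sub>v ols ?Z m = m"
    using train_design_mult_ols[of _ m] Z m eq
    by (intro eq_vecI) (auto simp: subvec_lessThan pick_lessThan simp del: index_mult_mat_vec)
  then show ?thesis
    unfolding design_eq[OF X \<alpha>] vec_space.col_space_eq[OF Z]
    using Z m ols_carrier[OF Z det_nz] by auto
qed

end

section \<open>White noise and the cross-validation setting\<close>

locale white_noise = prob_space M for M :: "'a measure" +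
  fixes e :: "nat \<Rightarrow> 'a \<Rightarrow> real" and \<sigma> :: real
  assumes e_measurable [measurable]: "e j \<in> borel_measurable M"
    and e_integrable_prod: "integrable M (\<lambda>\<omega>. e i \<omega> * e j \<omega>)"
    and e_cov: "expectation (\<lambda>\<omega>. e i \<omega> * e j \<omega>) = (if i = j then \<sigma>\<^sup>2 else 0)"
begin

text \<open>Expand the square into a double sum; uncorrelated errors leave only the diagonal in
  expectation.\<close>

lemma noise_ip_sq:
  "integrable M (\<lambda>\<omega>. (ip I w (\<lambda>j. e j \<omega>))\<^sup>2)"
  "finite I \<Longrightarrow> expectation (\<lambda>\<omega>. (ip I w (\<lambda>j. e j \<omega>))\<^sup>2) = \<sigma>\<^sup>2 * ip I w w"
proof -
  have eq: "(ip I w (\<lambda>j. e j \<omega>))\<^sup>2 = (\<Sum>i\<in>I. \<Sum>j\<in>I. w i * w j * (e i \<omega> * e j \<omega>))" for \<omega>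
    by (simp add: ip_def power2_eq_square sum_product mult_ac)
  show "integrable M (\<lambda>\<omega>. (ip I w (\<lambda>j. e j \<omega>))\<^sup>2)"
    unfolding eq by (intro Bochner_Integration.integrable_sum integrable_mult_right e_integrable_prod)
  assume fin: "finite I"
  have "expectation (\<lambda>\<omega>. (ip I w (\<lambda>j. e j \<omega>))\<^sup>2) = (\<Sum>i\<in>I. \<Sum>j\<in>I. w i * w j * (if i = j then \<sigma>\<^sup>2 else 0))"
    unfolding eq e_cov[symmetric]
    by (simp add: Bochner_Integration.integral_sum e_integrable_prod integrable_mult_right)
  also have "\<dots> = (\<Sum>i\<in>I. w i * w i * \<sigma>\<^sup>2)"
    using fin by (simp add: if_distrib[of "\<lambda>y. _ * y"] cong: if_cong)
  finally show "expectation (\<lambda>\<omega>. (ip I w (\<lambda>j. e j \<omega>))\<^sup>2) = \<sigma>\<^sup>2 * ip I w w"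
    by (simp add: ip_def sum_distrib_left mult_ac)
qed

text \<open>Each coordinate of the errors along a unit vector has second moment
  \<open>\<sigma>\<^sup>2\<close>, and there are \<open>d\<close> of them.\<close>

lemma noise_proj_energy:
  assumes "finite I" "orthonormal I d q"
  shows "integrable M (\<lambda>\<omega>. proj_energy I d q (\<lambda>j. e j \<omega>))"
    "expectation (\<lambda>\<omega>. proj_energy I d q (\<lambda>j. e j \<omega>)) = \<sigma>\<^sup>2 * real d"
proof -
  show "integrable M (\<lambda>\<omega>. proj_energy I d q (\<lambda>j. e j \<omega>))"
    unfolding proj_energy_def by (intro Bochner_Integration.integrable_sum noise_ip_sq(1))
  have "expectation (\<lambda>\<omega>. proj_energy I d q (\<lambda>j. e j \<omega>)) = (\<Sum>a<d. \<sigma>\<^sup>2 * ip I (q a) (q a))"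
    unfolding proj_energy_def noise_ip_sq(2)[OF assms(1), symmetric]
    by (intro Bochner_Integration.integral_sum noise_ip_sq(1))
  also have "\<dots> = \<sigma>\<^sup>2 * real d"
    using assms(2) by (simp add: orthonormal_def)
  finally show "expectation (\<lambda>\<omega>. proj_energy I d q (\<lambda>j. e j \<omega>)) = \<sigma>\<^sup>2 * real d" .
qed

end

text \<open>For distinct indices the expected product factorises into means, which are 0; on the
  diagonal the second moment is the variance.\<close>

lemma (in prob_space) white_noise_indep:
  fixes e :: "nat \<Rightarrow> 'a \<Rightarrow> real"
  assumes indep: "indep_vars (\<lambda>_. borel) e UNIV"
    and sq_int: "\<And>j. integrable M (\<lambda>\<omega>. (e j \<omega>)\<^sup>2)"
    and mean: "\<And>j. expectation (e j) = 0"
    and var: "\<And>j. variance (e j) = \<sigma>\<^sup>2"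
  shows "white_noise M e \<sigma>"
proof -
  have meas: "e j \<in> borel_measurable M" for j
    using indep by (simp add: indep_vars_def)
  have int: "integrable M (e j)" for j
    using square_integrable_imp_integrable[OF meas sq_int] .
  have prod: "integrable M (\<lambda>\<omega>. e i \<omega> * e j \<omega>) \<and> expectation (\<lambda>\<omega>. e i \<omega> * e j \<omega>) = (if i = j then \<sigma>\<^sup>2 else 0)"
    for i j
  proof (cases "i = j")
    case True
    then show ?thesis using sq_int[of j] var[of j] mean[of j] by (simp add: power2_eq_square)
  next
    case False
    have "indep_vars (\<lambda>_. borel) e {i, j}" by (rule indep_vars_subset[OF indep]) simp
    then have "expectation (\<lambda>\<omega>. \<Prod>l\<in>{i, j}. e l \<omega>) = (\<Prod>l\<in>{i, j}. expectation (e l))"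
      and "integrable M (\<lambda>\<omega>. \<Prod>l\<in>{i, j}. e l \<omega>)"
      using int by (intro indep_vars_lebesgue_integral indep_vars_integrable; simp)+
    then show ?thesis using False mean by simp
  qed
  interpret prob_space M by (rule prob_space_axioms)
  show ?thesis using meas prod by unfold_locales auto
qed

section \<open>Cross-validation at a fixed sample size\<close>

locale cv_setting = white_noise M e \<sigma> for M :: "'a measure" and e :: "nat \<Rightarrow> 'a \<Rightarrow> real" and \<sigma> :: real +
  fixes n p k r :: nat and X :: "real Matrix.mat" and \<mu> :: "real Matrix.vec"
    and A :: "nat set set" and T :: "nat \<Rightarrow> nat set"
  assumes n_pos: "n > 0"
    and mu_dim: "\<mu> \<in> carrier_vec n"
    and X_dim: "X \<in> carrier_mat n p"
    and models_nonempty: "A \<noteq> {}"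
    and models: "\<And>\<alpha>. \<alpha> \<in> A \<Longrightarrow> \<alpha> \<noteq> {} \<and> \<alpha> \<subseteq> {..<p}"
    and incorrect: "\<And>\<alpha>. \<alpha> \<in> A \<Longrightarrow> \<mu> \<notin> vec_space.col_space n (design X \<alpha>)"
    and k_range: "1 \<le> k \<and> k < n"
    and r_pos: "r \<ge> 1"
    and train: "\<And>i. i < r \<Longrightarrow> T i \<subseteq> {..<n} \<and> card (T i) = n - k"
    and balanced: "\<exists>c. \<forall>j<n. card {i. i < r \<and> j \<in> T i} = c"
    and nonsing: "\<And>i \<alpha>. i < r \<Longrightarrow> \<alpha> \<in> A \<Longrightarrow> invertible_mat (gram (train_design X (T i) \<alpha>))"
begin

abbreviation N where "N \<equiv> {..<n}"
abbreviation \<epsilon> where "\<epsilon> \<equiv> \<lambda>\<omega> j. e j \<omega>"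
abbreviation Y where "Y \<equiv> \<lambda>\<omega>. \<mu> + err_vec e n \<omega>"
abbreviation det_gram where "det_gram \<equiv> \<lambda>I \<alpha>. Determinant.det (gram (train_design X I \<alpha>))"

lemma finite_A: "finite A"
  using models by (intro finite_subset[of A "Pow {..<p}"]) auto

lemma finite_T: "i < r \<Longrightarrow> finite (T i)"
  using train finite_subset by blast

text \<open>\<open>gram_det_mono\<close> gives nonnegativity and the comparison; nonsingularity of
  the training Gram matrix makes the sign strict.\<close>

lemma det_gram_mono:
  assumes "i < r" "\<alpha> \<in> A"
  shows "0 < det_gram (T i) \<alpha>" "det_gram (T i) \<alpha> \<le> det_gram N \<alpha>"
proof -
  have T: "T i \<subseteq> N" and \<alpha>: "\<alpha> \<subseteq> {..<p}" using train models assms by auto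
  have "det_gram (T i) \<alpha> \<noteq> 0"
    using nonsing[OF assms] by (intro invertible_mat_det_nonzero[where c = "card \<alpha>"])
      (simp_all add: gram_train_design[OF X_dim T \<alpha>])
  moreover have "0 \<le> det_gram (T i) \<alpha> \<and> det_gram (T i) \<alpha> \<le> det_gram N \<alpha>"
    unfolding det_gram_train_design[OF X_dim T \<alpha>] det_gram_train_design[OF X_dim subset_refl \<alpha>]
    by (rule gram_det_mono) (use T in auto)
  ultimately show "0 < det_gram (T i) \<alpha>" "det_gram (T i) \<alpha> \<le> det_gram N \<alpha>" by auto
qed

lemma train_subdesign: "i < r \<Longrightarrow> \<alpha> \<in> A \<Longrightarrow> subdesign X n p (T i) \<alpha>"
  using X_dim train models det_gram_mono(1)[of i \<alpha>] by (simp add: subdesign_def)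

text \<open>The full Gram matrix inherits nonsingularity from the training sample
  \<open>T 0\<close>, which exists because \<open>r\<close> is at least 1.\<close>

lemma full_subdesign: "\<alpha> \<in> A \<Longrightarrow> full_subdesign X n p \<alpha>"
  using X_dim models det_gram_mono[of 0 \<alpha>] r_pos
  by (auto simp: full_subdesign_def subdesign_def)

lemma err_carrier: "err_vec e n \<omega> \<in> carrier_vec n"
  by (simp add: err_vec_def)

lemma Y_carrier: "Y \<omega> \<in> carrier_vec n"
  using mu_dim err_carrier by simp

lemma Y_index: "j < n \<Longrightarrow> vec_index (Y \<omega>) j = vec_index \<mu> j + e j \<omega>"
  by (simp add: err_vec_def)

section \<open>Bias, fitted noise and risk\<close>

definition full_fit :: "nat set \<Rightarrow> real Matrix.vec \<Rightarrow> nat \<Rightarrow> real" where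
  "full_fit \<alpha> = subdesign.fit X N \<alpha>"

definition bias :: "nat set \<Rightarrow> nat \<Rightarrow> real" where
  "bias \<alpha> j = vec_index \<mu> j - full_fit \<alpha> \<mu> j"

text \<open>This is n times Delta_n(alpha), the squared length of the part of the mean that the
  model misses.\<close>

definition \<delta> :: "nat set \<Rightarrow> real" where
  "\<delta> \<alpha> = ip N (bias \<alpha>) (bias \<alpha>)"

definition noise_fit :: "nat set \<Rightarrow> 'a \<Rightarrow> nat \<Rightarrow> real" where
  "noise_fit \<alpha> \<omega> = full_fit \<alpha> (err_vec e n \<omega>)"

definition R :: "nat set \<Rightarrow> real" where "R \<alpha> = real n * risk M e n X \<mu> \<alpha>"

definition D :: real where "D = (MIN \<alpha>\<in>A. R \<alpha>)"

text \<open>An orthonormal basis, over the rows in \<open>I\<close>, of the span of all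
  \<open>p\<close> columns. It serves every model at once, since each model uses a subset of these
  columns.\<close>

definition spanning :: "nat set \<Rightarrow> nat \<Rightarrow> (nat \<Rightarrow> nat \<Rightarrow> real) \<Rightarrow> bool" where
  "spanning I d q \<longleftrightarrow> d \<le> p \<and> orthonormal I d q \<and>
     (\<forall>c<p. \<forall>j\<in>I. orth_proj I d q (\<lambda>j. X $$ (j, c)) j = X $$ (j, c))"

definition span_dim :: "nat set \<Rightarrow> nat" where "span_dim I = (SOME d. \<exists>q. spanning I d q)"
definition span_basis :: "nat set \<Rightarrow> nat \<Rightarrow> nat \<Rightarrow> real" where "span_basis I = (SOME q. spanning I (span_dim I) q)"

lemma spanning_span_basis:
  assumes "finite I"
  shows "spanning I (span_dim I) (span_basis I)"
proof -
  have "\<exists>d q. spanning I d q"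
    using orthonormal_basis_exists[OF assms, of p "\<lambda>c j. X $$ (j, c)"] by (simp add: spanning_def)
  then have "\<exists>q. spanning I (span_dim I) q" unfolding span_dim_def by (rule someI_ex)
  then show ?thesis unfolding span_basis_def by (rule someI_ex)
qed

lemma basis:
  assumes "finite I"
  shows "span_dim I \<le> p" "orthonormal I (span_dim I) (span_basis I)"
  using spanning_span_basis[OF assms] by (auto simp: spanning_def)

text \<open>A fit is a combination of columns wherever its coefficients were computed, so
  \<open>J\<close> may differ from \<open>I\<close>: a full-sample fit restricted to a training
  sample stays in the span there.\<close>

lemma orth_proj_fit:
  assumes "finite I" "subdesign X n p J \<alpha>" "j \<in> I"
  shows "orth_proj I (span_dim I) (span_basis I) (subdesign.fit X J \<alpha> v) j = subdesign.fit X J \<alpha> v j"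
proof -
  have "pick \<alpha> a < p" if "a < card \<alpha>" for a
    using pick_in_set_le[OF that] assms(2) by (auto simp: subdesign_def)
  then show ?thesis
    unfolding subdesign.fit_def[OF assms(2), abs_def]
    using spanning_span_basis[OF assms(1)] assms(3)
    by (intro orth_proj_lin_comb) (auto simp: spanning_def)
qed

text \<open>\<open>U I\<close>, \<open>W I\<close> and \<open>D\<close> do not depend on the model, which makes the bounds below uniform
  over the candidate models.\<close>

definition U :: "nat set \<Rightarrow> 'a \<Rightarrow> real" where
  "U I \<omega> = proj_energy I (span_dim I) (span_basis I) (\<epsilon> \<omega>)"

definition \<rho> :: "nat set \<Rightarrow> nat \<Rightarrow> real" where
  "\<rho> I = orth_res I (span_dim I) (span_basis I) (vec_index \<mu>)"

definition W :: "nat set \<Rightarrow> 'a \<Rightarrow> real" where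
  "W I \<omega> = ip I (\<rho> I) (\<epsilon> \<omega>)"

lemma U_nonneg: "0 \<le> U I \<omega>"
  by (simp add: U_def proj_energy_nonneg)

lemma U_moment:
  assumes "finite I"
  shows "integrable M (U I)" "expectation (U I) \<le> \<sigma>\<^sup>2 * real p"
proof -
  note b = basis[OF assms]
  show "integrable M (U I)"
    unfolding U_def[abs_def] by (rule noise_proj_energy[OF assms b(2)])
  show "expectation (U I) \<le> \<sigma>\<^sup>2 * real p"
    unfolding U_def[abs_def] noise_proj_energy(2)[OF assms b(2)]
    using b(1) by (intro mult_left_mono) auto
qed

text \<open>The bias is the mean minus a function in the span of all columns, and taking residuals
  removes that function. This is why the noise terms can be compared with quantities free of the
  model.\<close>

lemma \<rho>_bias:
  assumes "\<alpha> \<in> A" "finite I" "j \<in> I"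
  shows "orth_res I (span_dim I) (span_basis I) (bias \<alpha>) j = \<rho> I j"
proof -
  have "subdesign X n p N \<alpha>" using full_subdesign[OF assms(1)] by (simp add: full_subdesign_def)
  then show ?thesis unfolding bias_def[abs_def] \<rho>_def full_fit_def
    using orth_proj_fit[OF assms(2)] assms(3)
    by (intro orth_res_diff_fixed) auto
qed

text \<open>Passing to the residual and restricting to fewer rows can only shrink the norm of the
  bias.\<close>

lemma \<rho>_le:
  assumes "\<alpha> \<in> A" "I \<subseteq> N"
  shows "ip I (\<rho> I) (\<rho> I) \<le> \<delta> \<alpha>"
proof -
  have fin: "finite I" using assms(2) finite_subset by blast
  have "ip I (\<rho> I) (\<rho> I) = ip I (orth_res I (span_dim I) (span_basis I) (bias \<alpha>)) (orth_res I (span_dim I) (span_basis I) (bias \<alpha>))"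
    using \<rho>_bias[OF assms(1) fin] by (intro ip_cong) auto
  also have "\<dots> \<le> ip I (bias \<alpha>) (bias \<alpha>)" by (rule ip_orth_res_le[OF basis(2)[OF fin]])
  also have "\<dots> \<le> \<delta> \<alpha>" unfolding \<delta>_def using assms(2) by (intro ip_self_mono) auto
  finally show ?thesis .
qed

lemma W_moment:
  assumes "I \<subseteq> N"
  shows "integrable M (\<lambda>\<omega>. (W I \<omega>)\<^sup>2)"
    and "\<alpha> \<in> A \<Longrightarrow> expectation (\<lambda>\<omega>. (W I \<omega>)\<^sup>2) \<le> \<sigma>\<^sup>2 * \<delta> \<alpha>"
proof -
  have fin: "finite I" using assms finite_subset by blast
  show "integrable M (\<lambda>\<omega>. (W I \<omega>)\<^sup>2)" unfolding W_def by (rule noise_ip_sq)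
  show "\<alpha> \<in> A \<Longrightarrow> expectation (\<lambda>\<omega>. (W I \<omega>)\<^sup>2) \<le> \<sigma>\<^sup>2 * \<delta> \<alpha>"
    unfolding W_def noise_ip_sq(2)[OF fin] using assms by (intro mult_left_mono \<rho>_le) auto
qed

lemma full_fit_Y: "\<alpha> \<in> A \<Longrightarrow> full_fit \<alpha> (Y \<omega>) j = full_fit \<alpha> \<mu> j + noise_fit \<alpha> \<omega> j"
  unfolding full_fit_def noise_fit_def
  by (rule subdesign.fit_add[OF full_subdesign[unfolded full_subdesign_def] mu_dim err_carrier])

lemma bias_orth:
  "\<alpha> \<in> A \<Longrightarrow> ip N (bias \<alpha>) (noise_fit \<alpha> \<omega>) = 0"
  using full_subdesign mu_dim unfolding bias_def[abs_def] full_fit_def noise_fit_def full_subdesign_def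
  by (intro subdesign.fit_orth_fit)

lemma noise_fit_orth:
  assumes "\<alpha> \<in> A"
  shows "ip N (\<epsilon> \<omega>) (noise_fit \<alpha> \<omega>) = ip N (noise_fit \<alpha> \<omega>) (noise_fit \<alpha> \<omega>)"
proof -
  have "ip N (\<lambda>j. vec_index (err_vec e n \<omega>) j - noise_fit \<alpha> \<omega> j) (noise_fit \<alpha> \<omega>) = 0"
    using full_subdesign[OF assms] err_carrier unfolding full_fit_def noise_fit_def full_subdesign_def
    by (intro subdesign.fit_orth_fit)
  moreover have "ip N (vec_index (err_vec e n \<omega>)) v = ip N (\<epsilon> \<omega>) v" for v
    by (intro ip_cong) (auto simp: err_vec_def)
  ultimately show ?thesis by (simp add: ip_diff_left)
qed

text \<open>The fitted noise lies in the span of all columns, and its inner product with the errors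
  is its own squared norm, so \<open>fit_energy_le\<close> applies.\<close>

lemma noise_fit_le: "\<alpha> \<in> A \<Longrightarrow> ip N (noise_fit \<alpha> \<omega>) (noise_fit \<alpha> \<omega>) \<le> U N \<omega>"
  unfolding U_def using full_subdesign[of \<alpha>]
  by (intro fit_energy_le basis noise_fit_orth[symmetric])
     (auto simp: noise_fit_def full_fit_def full_subdesign_def intro!: orth_proj_fit)

lemma noise_fit_measurable [measurable]:
  assumes "\<alpha> \<in> A"
  shows "(\<lambda>\<omega>. noise_fit \<alpha> \<omega> j) \<in> borel_measurable M"
  using full_subdesign[OF assms] unfolding noise_fit_def full_fit_def full_subdesign_def
  by (intro subdesign.fit_measurable[OF _ err_carrier]) (auto simp: err_vec_def)

text \<open>Pythagoras: the bias is orthogonal to the fitted noise, so the loss splits without a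
  cross term.\<close>

lemma loss_eq:
  assumes "\<alpha> \<in> A"
  shows "real n * loss n X \<mu> (Y \<omega>) \<alpha> = \<delta> \<alpha> + ip N (noise_fit \<alpha> \<omega>) (noise_fit \<alpha> \<omega>)"
proof -
  have "real n * loss n X \<mu> (Y \<omega>) \<alpha>
    = ip N (\<lambda>j. vec_index \<mu> j - full_fit \<alpha> (Y \<omega>) j) (\<lambda>j. vec_index \<mu> j - full_fit \<alpha> (Y \<omega>) j)"
    using n_pos full_subdesign.loss_eq[OF full_subdesign[OF assms] mu_dim Y_carrier]
    by (simp add: full_fit_def)
  also have "(\<lambda>j. vec_index \<mu> j - full_fit \<alpha> (Y \<omega>) j) = (\<lambda>j. bias \<alpha> j - noise_fit \<alpha> \<omega> j)"
    using full_fit_Y[OF assms] by (simp add: bias_def fun_eq_iff)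
  finally show ?thesis
    using bias_orth[OF assms, of \<omega>]
    by (simp add: ip_diff_left ip_diff_right \<delta>_def ip_commute[of N "noise_fit \<alpha> \<omega>" "bias \<alpha>"])
qed

lemma \<delta>_pos:
  assumes "\<alpha> \<in> A"
  shows "0 < \<delta> \<alpha>"
proof (rule ccontr)
  assume "\<not> 0 < \<delta> \<alpha>"
  then have "\<delta> \<alpha> = 0" using ip_self_nonneg[of N "bias \<alpha>"] by (simp add: \<delta>_def)
  then have "\<And>j. j < n \<Longrightarrow> vec_index \<mu> j = subdesign.fit X N \<alpha> \<mu> j"
    by (simp add: \<delta>_def ip_self_eq_0 bias_def full_fit_def)
  from full_subdesign.fit_in_col_space[OF full_subdesign[OF assms] mu_dim this] incorrect[OF assms]
  show False by blast
qed

lemma noise_fit_integrable: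
  assumes "\<alpha> \<in> A"
  shows "integrable M (\<lambda>\<omega>. ip N (noise_fit \<alpha> \<omega>) (noise_fit \<alpha> \<omega>))"
proof (rule Bochner_Integration.integrable_bound[OF U_moment(1)[of N]])
  show "(\<lambda>\<omega>. ip N (noise_fit \<alpha> \<omega>) (noise_fit \<alpha> \<omega>)) \<in> borel_measurable M"
    using noise_fit_measurable[OF assms] unfolding ip_def by measurable
qed (use noise_fit_le[OF assms] in \<open>auto simp: ip_self_nonneg U_nonneg\<close>)

lemma R_eq:
  assumes "\<alpha> \<in> A"
  shows "R \<alpha> = \<delta> \<alpha> + expectation (\<lambda>\<omega>. ip N (noise_fit \<alpha> \<omega>) (noise_fit \<alpha> \<omega>))"
proof -
  have "R \<alpha> = expectation (\<lambda>\<omega>. real n * loss n X \<mu> (Y \<omega>) \<alpha>)"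
    by (simp add: R_def risk_def)
  also have "\<dots> = \<delta> \<alpha> + expectation (\<lambda>\<omega>. ip N (noise_fit \<alpha> \<omega>) (noise_fit \<alpha> \<omega>))"
    unfolding loss_eq[OF assms] using noise_fit_integrable[OF assms] by (simp add: prob_space)
  finally show ?thesis .
qed

text \<open>The risk adds to the squared bias the expected energy of the fitted noise, which is
  nonnegative and at most the expectation of \<open>U N\<close>.\<close>

lemma R_bounds:
  assumes "\<alpha> \<in> A"
  shows "\<delta> \<alpha> \<le> R \<alpha>" "R \<alpha> \<le> \<delta> \<alpha> + \<sigma>\<^sup>2 * real p"
proof -
  show "\<delta> \<alpha> \<le> R \<alpha>" unfolding R_eq[OF assms] by (simp add: ip_self_nonneg)
  have "expectation (\<lambda>\<omega>. ip N (noise_fit \<alpha> \<omega>) (noise_fit \<alpha> \<omega>)) \<le> expectation (U N)"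
    using noise_fit_le[OF assms] by (intro integral_mono noise_fit_integrable U_moment assms) auto
  also have "\<dots> \<le> \<sigma>\<^sup>2 * real p" by (rule U_moment) simp
  finally show "R \<alpha> \<le> \<delta> \<alpha> + \<sigma>\<^sup>2 * real p" unfolding R_eq[OF assms] by simp
qed

lemma D_le: "\<alpha> \<in> A \<Longrightarrow> D \<le> R \<alpha>"
  unfolding D_def using finite_A by simp

lemma D_attained: obtains \<alpha> where "\<alpha> \<in> A" "D = R \<alpha>"
proof -
  have "D \<in> R ` A" unfolding D_def using finite_A models_nonempty by (intro Min_in) auto
  then show ?thesis using that by blast
qed

lemma D_pos: "0 < D"
proof -
  obtain \<alpha> where "\<alpha> \<in> A" "D = R \<alpha>" by (rule D_attained)
  then show ?thesis using \<delta>_pos[of \<alpha>] R_bounds(1)[of \<alpha>] by simp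
qed

text \<open>The left side is free of the model, so \<open>W_moment\<close> may be used at a
  minimiser of the risk, where the squared bias is at most \<open>D\<close>.\<close>

lemma W_moment_D: "I \<subseteq> N \<Longrightarrow> expectation (\<lambda>\<omega>. (W I \<omega>)\<^sup>2) \<le> \<sigma>\<^sup>2 * D"
proof -
  assume I: "I \<subseteq> N"
  obtain \<alpha> where \<alpha>: "\<alpha> \<in> A" "D = R \<alpha>" by (rule D_attained)
  have "expectation (\<lambda>\<omega>. (W I \<omega>)\<^sup>2) \<le> \<sigma>\<^sup>2 * \<delta> \<alpha>" by (rule W_moment(2)[OF I \<alpha>(1)])
  also have "\<dots> \<le> \<sigma>\<^sup>2 * D" using \<alpha> R_bounds(1)[of \<alpha>] by (intro mult_left_mono) auto
  finally show ?thesis .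
qed

text \<open>Double counting: by balance each row lies in the same number \<open>c\<close> of
  samples, so the sum over all samples is \<open>c\<close> times the full sum.\<close>

lemma train_avg:
  "(\<Sum>i<r. ip (T i) f f) / real r = real (n - k) / real n * ip N f f"
proof -
  obtain c where c: "\<And>j. j < n \<Longrightarrow> card {i. i < r \<and> j \<in> T i} = c" using balanced by blast
  have sum: "(\<Sum>i<r. \<Sum>j\<in>T i. g j) = real c * (\<Sum>j<n. g j)" for g :: "nat \<Rightarrow> real"
  proof -
    have "(\<Sum>i<r. \<Sum>j\<in>T i. g j) = (\<Sum>i<r. \<Sum>j<n. if j \<in> T i then g j else 0)"
      using train by (intro sum.cong refl sum.mono_neutral_cong_left) auto
    also have "\<dots> = (\<Sum>j<n. \<Sum>i<r. if j \<in> T i then g j else 0)" by (rule sum.swap)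
    also have "\<dots> = (\<Sum>j<n. real (card {i. i < r \<and> j \<in> T i}) * g j)"
      by (intro sum.cong refl) (simp add: sum.If_cases Int_def)
    also have "\<dots> = real c * (\<Sum>j<n. g j)" using c by (simp add: sum_distrib_left)
    finally show ?thesis .
  qed
  \<comment> \<open>The constant function 1 counts the pairs of a sample and a row in it, which
    determines \<open>c\<close>.\<close>
  have "real r * real (n - k) = real c * real n"
    using sum[of "\<lambda>_. 1"] train by simp
  then have "real c / real r = real (n - k) / real n"
    using r_pos n_pos by (simp add: field_simps)
  then show ?thesis unfolding ip_def sum by (metis times_divide_eq_left)
qed

end

section \<open>Deviation of the criterion from the loss\<close>

context cv_setting
begin

definition L :: "'a \<Rightarrow> nat set \<Rightarrow> real" where "L \<omega> \<alpha> = loss n X \<mu> (Y \<omega>) \<alpha>"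

definition G :: "'a \<Rightarrow> nat set \<Rightarrow> real" where "G \<omega> \<alpha> = crit n (\<sigma>\<^sup>2) X r T (Y \<omega>) \<alpha>"

definition shift :: "'a \<Rightarrow> real" where
  "shift \<omega> = real k / (real n)\<^sup>2 * sq_norm (err_vec e n \<omega>)"

definition deviation :: "'a \<Rightarrow> real" where
  "deviation \<omega> = (MAX \<alpha>\<in>A. \<bar>G \<omega> \<alpha> - shift \<omega> - L \<omega> \<alpha>\<bar> / L \<omega> \<alpha>)"

lemma n_L: "\<alpha> \<in> A \<Longrightarrow> real n * L \<omega> \<alpha> = \<delta> \<alpha> + ip N (noise_fit \<alpha> \<omega>) (noise_fit \<alpha> \<omega>)"
  by (simp add: L_def loss_eq)

lemma n_L_ge: "\<alpha> \<in> A \<Longrightarrow> \<delta> \<alpha> \<le> real n * L \<omega> \<alpha>"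
  by (simp add: n_L ip_self_nonneg)

lemma L_pos: "\<alpha> \<in> A \<Longrightarrow> 0 < L \<omega> \<alpha>"
  using n_L_ge[of \<alpha> \<omega>] \<delta>_pos[of \<alpha>] n_pos
  by (metis less_le_trans of_nat_0_less_iff zero_less_mult_pos)

text \<open>The residual is the bias plus the errors minus the fitted noise. The bias is orthogonal
  to the fitted noise, and \<open>noise_fit_orth\<close> evaluates the product of the errors with
  it.\<close>

lemma full_rss:
  assumes "\<alpha> \<in> A"
  shows "rss (design X \<alpha>) (Y \<omega>) = \<delta> \<alpha> + ip N (\<epsilon> \<omega>) (\<epsilon> \<omega>)
    - ip N (noise_fit \<alpha> \<omega>) (noise_fit \<alpha> \<omega>) + 2 * ip N (\<epsilon> \<omega>) (bias \<alpha>)"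
proof -
  have "\<alpha> \<subseteq> {..<p}" using models assms by auto
  then have "rss (design X \<alpha>) (Y \<omega>)
      = ip N (\<lambda>j. vec_index (Y \<omega>) j - full_fit \<alpha> (Y \<omega>) j) (\<lambda>j. vec_index (Y \<omega>) j - full_fit \<alpha> (Y \<omega>) j)"
    using subdesign.rss_eq[OF full_subdesign[OF assms, unfolded full_subdesign_def] Y_carrier]
    by (simp add: design_eq[OF X_dim] subvec_lessThan[OF Y_carrier] full_fit_def)
  also have "\<dots> = ip N (\<lambda>j. bias \<alpha> j + (e j \<omega> - noise_fit \<alpha> \<omega> j)) (\<lambda>j. bias \<alpha> j + (e j \<omega> - noise_fit \<alpha> \<omega> j))"
    using Y_index[of _ \<omega>] full_fit_Y[OF assms] by (intro ip_cong) (simp_all add: bias_def)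
  finally show ?thesis
    using bias_orth[OF assms, of \<omega>] noise_fit_orth[OF assms, of \<omega>]
      ip_commute[of N "noise_fit \<alpha> \<omega>" "bias \<alpha>"] ip_commute[of N "bias \<alpha>" "\<epsilon> \<omega>"]
      ip_commute[of N "noise_fit \<alpha> \<omega>" "\<epsilon> \<omega>"]
    by (simp add: ip_add_left ip_add_right ip_diff_left ip_diff_right \<delta>_def)
qed

definition train_rss :: "nat \<Rightarrow> 'a \<Rightarrow> nat set \<Rightarrow> real" where
  "train_rss i \<omega> \<alpha> = rss (train_design X (T i) \<alpha>) (subvec (Y \<omega>) (T i))"

text \<open>Least squares on the training rows does no worse than the coefficients of the
  full-sample fit to the mean, which leave exactly the bias plus the errors.\<close>

lemma train_rss_upper:
  assumes "\<alpha> \<in> A" "i < r"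
  shows "train_rss i \<omega> \<alpha> \<le> ip (T i) (\<lambda>j. bias \<alpha> j + e j \<omega>) (\<lambda>j. bias \<alpha> j + e j \<omega>)"
proof -
  let ?b = "vec_index (ols (train_design X N \<alpha>) (subvec \<mu> N))"
  have fit: "full_fit \<alpha> \<mu> j = (\<Sum>a<card \<alpha>. ?b a * X $$ (j, pick \<alpha> a))" for j
    unfolding full_fit_def
    by (rule subdesign.fit_def[OF full_subdesign[OF assms(1), unfolded full_subdesign_def]])
  have "train_rss i \<omega> \<alpha> \<le> ip (T i) (\<lambda>j. vec_index (Y \<omega>) j - full_fit \<alpha> \<mu> j)
      (\<lambda>j. vec_index (Y \<omega>) j - full_fit \<alpha> \<mu> j)"
    unfolding train_rss_def fit
    by (rule subdesign.rss_le[OF train_subdesign[OF assms(2,1)] Y_carrier])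
  also have "\<dots> = ip (T i) (\<lambda>j. bias \<alpha> j + e j \<omega>) (\<lambda>j. bias \<alpha> j + e j \<omega>)"
    using train[OF assms(2)] Y_index[of _ \<omega>] by (intro ip_cong) (auto simp: bias_def)
  finally show ?thesis .
qed

lemma train_rss_eq:
  "\<alpha> \<in> A \<Longrightarrow> i < r \<Longrightarrow> train_rss i \<omega> \<alpha>
    = ip (T i) (\<lambda>j. vec_index (Y \<omega>) j - subdesign.fit X (T i) \<alpha> (Y \<omega>) j)
               (\<lambda>j. vec_index (Y \<omega>) j - subdesign.fit X (T i) \<alpha> (Y \<omega>) j)"
  unfolding train_rss_def by (rule subdesign.rss_eq[OF train_subdesign Y_carrier])

text \<open>The training fit lies in the span over \<open>T i\<close>, so the mean minus this fit
  has residual \<open>\<rho> (T i)\<close> whatever the model; \<open>sq_dist_lower_bound\<close>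
  then gives a bound free of \<open>\<alpha>\<close>.\<close>

lemma train_rss_lower:
  assumes "\<alpha> \<in> A" "i < r"
  shows "ip (T i) (\<epsilon> \<omega>) (\<epsilon> \<omega>) - U (T i) \<omega> + 2 * W (T i) \<omega> \<le> train_rss i \<omega> \<alpha>"
proof -
  define g where "g = subdesign.fit X (T i) \<alpha> (Y \<omega>)"
  let ?w = "\<lambda>j. vec_index \<mu> j - g j"
  note fin = finite_T[OF assms(2)]
  have "train_rss i \<omega> \<alpha> = ip (T i) (\<lambda>j. ?w j + e j \<omega>) (\<lambda>j. ?w j + e j \<omega>)"
    unfolding train_rss_eq[OF assms] g_def
    using train[OF assms(2)] Y_index[of _ \<omega>] by (intro ip_cong) auto
  moreover have "ip (T i) (\<epsilon> \<omega>) (orth_res (T i) (span_dim (T i)) (span_basis (T i)) ?w) = W (T i) \<omega>"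
    unfolding W_def \<rho>_def ip_commute[of "T i" _ "\<epsilon> \<omega>"]
    using orth_proj_fit[OF fin train_subdesign[OF assms(2,1)]]
    by (intro ip_cong orth_res_diff_fixed) (auto simp: g_def)
  ultimately show ?thesis
    using sq_dist_lower_bound[OF basis(2)[OF fin], of "\<epsilon> \<omega>" ?w] by (simp add: U_def)
qed

section \<open>Averages over the training samples\<close>

definition avg :: "(nat \<Rightarrow> real) \<Rightarrow> real" where "avg f = (\<Sum>i<r. f i) / real r"

lemma avg_mono: "(\<And>i. i < r \<Longrightarrow> f i \<le> g i) \<Longrightarrow> avg f \<le> avg g"
  unfolding avg_def by (intro divide_right_mono sum_mono) auto

lemma avg_nonneg: "(\<And>i. i < r \<Longrightarrow> 0 \<le> f i) \<Longrightarrow> 0 \<le> avg f"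
  unfolding avg_def by (intro divide_nonneg_nonneg sum_nonneg) auto

lemma avg_const: "avg (\<lambda>_. c) = c"
  using r_pos by (simp add: avg_def)

lemma avg_add: "avg (\<lambda>i. f i + g i) = avg f + avg g"
  by (simp add: avg_def sum.distrib add_divide_distrib)

lemma avg_diff: "avg (\<lambda>i. f i - g i) = avg f - avg g"
  by (simp add: avg_def sum_subtractf diff_divide_distrib)

lemma avg_cmult: "avg (\<lambda>i. c * f i) = c * avg f"
  by (simp add: avg_def sum_distrib_left)

text \<open>The variance of the values \<open>f i\<close> under the uniform weights is
  nonnegative.\<close>

lemma avg_sq_le: "(avg f)\<^sup>2 \<le> avg (\<lambda>i. (f i)\<^sup>2)"
proof -
  have "0 \<le> avg (\<lambda>i. (f i - avg f)\<^sup>2)" by (rule avg_nonneg) simp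
  also have "(\<lambda>i. (f i - avg f)\<^sup>2) = (\<lambda>i. (f i)\<^sup>2 - (2 * avg f) * f i + (avg f)\<^sup>2)"
    by (simp add: power2_diff mult_ac fun_eq_iff)
  also have "avg \<dots> = avg (\<lambda>i. (f i)\<^sup>2) - (avg f)\<^sup>2"
    unfolding avg_add avg_diff avg_cmult avg_const by (simp add: power2_eq_square)
  finally show ?thesis by simp
qed

section \<open>Decomposition of the criterion\<close>

abbreviation \<phi> :: real where "\<phi> \<equiv> real (n - k) / real n"

abbreviation log_ratio :: "nat set \<Rightarrow> nat \<Rightarrow> real" where
  "log_ratio \<alpha> i \<equiv> ln (Determinant.det (gram (design X \<alpha>)) / det_gram (T i) \<alpha>)"

lemma log_ratio_nonneg: "\<alpha> \<in> A \<Longrightarrow> i < r \<Longrightarrow> 0 \<le> log_ratio \<alpha> i"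
  using det_gram_mono[of i \<alpha>] models[of \<alpha>] by (simp add: design_eq[OF X_dim])

text \<open>\<open>a_coef\<close> is the log ratio after rescaling by a power of
  \<open>\<phi>\<close>; separating that power produces the logarithm controlled by condition (ii),
  and leaves the term controlled by (iii).\<close>

lemma log_ratio_eq:
  assumes "\<alpha> \<in> A" "i < r"
  shows "log_ratio \<alpha> i = a_coef n k X (T i) \<alpha> + real (card \<alpha>) * ln (real n / real (n - k))"
proof -
  let ?q = "Determinant.det (gram (design X \<alpha>)) / det_gram (T i) \<alpha>"
  have q: "0 < ?q" using det_gram_mono[of i \<alpha>] models[of \<alpha>] assms by (simp add: design_eq[OF X_dim])
  have nk: "real (n - k) > 0" "real n > 0" using k_range by auto
  have "a_coef n k X (T i) \<alpha> = ln ((real (n - k) / real n) ^ card \<alpha> * ?q)"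
    unfolding a_coef_def by (simp add: power_divide)
  also have "\<dots> = real (card \<alpha>) * ln (real (n - k) / real n) + ln ?q"
    using q nk by (subst ln_mult) (auto simp: ln_realpow)
  also have "ln (real (n - k) / real n) = - ln (real n / real (n - k))"
    using nk by (simp add: ln_div)
  finally show ?thesis by simp
qed

text \<open>Since \<open>k / n\<close> is \<open>1 - \<phi>\<close>, the shift removes the error
  energy of the full residual sum of squares up to the fraction \<open>\<phi>\<close>, which is set
  against the training average. The squared bias cancels with the loss, and the fitted noise is
  counted twice.\<close>

lemma G_eq:
  assumes "\<alpha> \<in> A"
  shows "real n * (G \<omega> \<alpha> - shift \<omega> - L \<omega> \<alpha>) =
    2 * ip N (\<epsilon> \<omega>) (bias \<alpha>) - 2 * ip N (noise_fit \<alpha> \<omega>) (noise_fit \<alpha> \<omega>)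
    - (avg (\<lambda>i. train_rss i \<omega> \<alpha>) - \<phi> * ip N (\<epsilon> \<omega>) (\<epsilon> \<omega>)) + \<sigma>\<^sup>2 * avg (log_ratio \<alpha>)"
proof -
  have "real n * G \<omega> \<alpha> = rss (design X \<alpha>) (Y \<omega>) - avg (\<lambda>i. train_rss i \<omega> \<alpha>) + \<sigma>\<^sup>2 * avg (log_ratio \<alpha>)"
    using n_pos unfolding G_def crit_def avg_def train_rss_def
    by (simp add: sum_divide_distrib[symmetric] sum_distrib_left[symmetric] field_simps)
  moreover have "real n * shift \<omega> = (1 - \<phi>) * ip N (\<epsilon> \<omega>) (\<epsilon> \<omega>)"
    using n_pos k_range unfolding shift_def sq_norm_err_vec
    by (simp add: power2_eq_square field_simps of_nat_diff)
  ultimately show ?thesis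
    using n_L[OF assms, of \<omega>] by (simp add: full_rss[OF assms] algebra_simps)
qed

text \<open>A single random variable that controls the noise for all models. The different powers of
  \<open>D\<close> reflect that smallness of \<open>S\<close> should bound \<open>U\<close> and
  \<open>W\<close>, not the square of \<open>W\<close>, by small multiples of
  \<open>D\<close>.\<close>

definition S :: "'a \<Rightarrow> real" where
  "S \<omega> = (U N \<omega> + avg (\<lambda>i. U (T i) \<omega>)) / D + ((W N \<omega>)\<^sup>2 + avg (\<lambda>i. (W (T i) \<omega>)\<^sup>2)) / D\<^sup>2"

lemma S_nonneg: "0 \<le> S \<omega>"
  using D_pos unfolding S_def
  by (intro add_nonneg_nonneg divide_nonneg_nonneg avg_nonneg U_nonneg) auto

lemma p_pos: "1 \<le> p"
proof -
  obtain \<alpha> where "\<alpha> \<in> A" using models_nonempty by blast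
  then show ?thesis using models[of \<alpha>] by (cases p) auto
qed

text \<open>The \<open>U\<close> terms contribute at most
  \<open>2 * \<sigma>\<^sup>2 * p / D\<close>. The \<open>W\<close> terms contribute at most
  \<open>2 * \<sigma>\<^sup>2 / D\<close>, which is absorbed because \<open>p\<close> is at least
  1.\<close>

lemma S_moment: "integrable M S" "expectation S \<le> 4 * \<sigma>\<^sup>2 * (real p / D)"
proof -
  have intU: "integrable M (\<lambda>\<omega>. avg (\<lambda>i. U (T i) \<omega>))"
    unfolding avg_def using U_moment(1)[OF finite_T]
    by (intro integrable_divide Bochner_Integration.integrable_sum) auto
  have intW: "integrable M (\<lambda>\<omega>. avg (\<lambda>i. (W (T i) \<omega>)\<^sup>2))"
    unfolding avg_def using W_moment(1) train
    by (intro integrable_divide Bochner_Integration.integrable_sum) auto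
  have intN: "integrable M (U N)" "integrable M (\<lambda>\<omega>. (W N \<omega>)\<^sup>2)"
    using U_moment(1)[of N] W_moment(1)[of N] by auto
  show "integrable M S" unfolding S_def[abs_def]
    using intU intW intN by (intro Bochner_Integration.integrable_add integrable_divide)
  have "expectation (\<lambda>\<omega>. avg (\<lambda>i. U (T i) \<omega>)) = avg (\<lambda>i. expectation (U (T i)))"
    unfolding avg_def using U_moment(1)[OF finite_T]
    by (subst integral_divide_zero, subst Bochner_Integration.integral_sum) auto
  also have "\<dots> \<le> avg (\<lambda>_. \<sigma>\<^sup>2 * real p)"
    by (intro avg_mono U_moment finite_T)
  finally have EU: "expectation (\<lambda>\<omega>. avg (\<lambda>i. U (T i) \<omega>)) \<le> \<sigma>\<^sup>2 * real p" by (simp add: avg_const)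
  have "expectation (\<lambda>\<omega>. avg (\<lambda>i. (W (T i) \<omega>)\<^sup>2)) = avg (\<lambda>i. expectation (\<lambda>\<omega>. (W (T i) \<omega>)\<^sup>2))"
    unfolding avg_def using W_moment(1) train
    by (subst integral_divide_zero, subst Bochner_Integration.integral_sum) auto
  also have "\<dots> \<le> avg (\<lambda>_. \<sigma>\<^sup>2 * D)"
    using train by (intro avg_mono W_moment_D) auto
  finally have EW: "expectation (\<lambda>\<omega>. avg (\<lambda>i. (W (T i) \<omega>)\<^sup>2)) \<le> \<sigma>\<^sup>2 * D" by (simp add: avg_const)
  have "expectation S = (expectation (U N) + expectation (\<lambda>\<omega>. avg (\<lambda>i. U (T i) \<omega>))) / D
    + (expectation (\<lambda>\<omega>. (W N \<omega>)\<^sup>2) + expectation (\<lambda>\<omega>. avg (\<lambda>i. (W (T i) \<omega>)\<^sup>2))) / D\<^sup>2"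
    unfolding S_def[abs_def] using intU intW intN
    by (simp add: Bochner_Integration.integral_add)
  also have "\<dots> \<le> (\<sigma>\<^sup>2 * real p + \<sigma>\<^sup>2 * real p) / D + (\<sigma>\<^sup>2 * D + \<sigma>\<^sup>2 * D) / D\<^sup>2"
    using EU EW U_moment(2)[of N] W_moment_D[of N] D_pos
    by (intro add_mono divide_right_mono) auto
  also have "\<dots> = 2 * \<sigma>\<^sup>2 * (real p / D) + 2 * \<sigma>\<^sup>2 * (1 / D)"
    using D_pos by (simp add: power2_eq_square field_simps)
  also have "\<dots> \<le> 2 * \<sigma>\<^sup>2 * (real p / D) + 2 * \<sigma>\<^sup>2 * (real p / D)"
    using p_pos D_pos by (intro add_left_mono mult_left_mono divide_right_mono) auto
  finally show "expectation S \<le> 4 * \<sigma>\<^sup>2 * (real p / D)" by (simp add: mult_ac)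
qed

text \<open>Each of the four nonnegative summands of \<open>S\<close> is at most
  \<open>\<eta>\<^sup>2\<close>; for the averaged \<open>W\<close> the mean square dominates the
  squared mean.\<close>

lemma S_bounds:
  assumes "S \<omega> \<le> \<eta>\<^sup>2" "0 \<le> \<eta>"
  shows "U N \<omega> \<le> \<eta>\<^sup>2 * D" "avg (\<lambda>i. U (T i) \<omega>) \<le> \<eta>\<^sup>2 * D"
    "\<bar>W N \<omega>\<bar> \<le> \<eta> * D" "\<bar>avg (\<lambda>i. W (T i) \<omega>)\<bar> \<le> \<eta> * D"
proof -
  let ?V = "avg (\<lambda>i. U (T i) \<omega>)" and ?W = "avg (\<lambda>i. (W (T i) \<omega>)\<^sup>2)"
  have nonneg: "0 \<le> U N \<omega> / D" "0 \<le> ?V / D" "0 \<le> (W N \<omega>)\<^sup>2 / D\<^sup>2" "0 \<le> ?W / D\<^sup>2"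
    using D_pos by (intro divide_nonneg_nonneg avg_nonneg U_nonneg; simp)+
  have sum: "U N \<omega> / D + ?V / D + (W N \<omega>)\<^sup>2 / D\<^sup>2 + ?W / D\<^sup>2 \<le> \<eta>\<^sup>2"
    using assms(1) by (simp add: S_def add_divide_distrib)
  have "U N \<omega> / D \<le> \<eta>\<^sup>2" "?V / D \<le> \<eta>\<^sup>2" using sum nonneg by linarith+
  then show "U N \<omega> \<le> \<eta>\<^sup>2 * D" "?V \<le> \<eta>\<^sup>2 * D" using D_pos by (simp_all add: pos_divide_le_eq)
  have "(W N \<omega>)\<^sup>2 / D\<^sup>2 \<le> \<eta>\<^sup>2" "?W / D\<^sup>2 \<le> \<eta>\<^sup>2" using sum nonneg by linarith+
  then have "(W N \<omega>)\<^sup>2 \<le> (\<eta> * D)\<^sup>2" "?W \<le> (\<eta> * D)\<^sup>2"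
    using D_pos by (simp_all add: pos_divide_le_eq power_mult_distrib)
  moreover from this(2) have "(avg (\<lambda>i. W (T i) \<omega>))\<^sup>2 \<le> (\<eta> * D)\<^sup>2"
    by (rule order_trans[OF avg_sq_le])
  ultimately show "\<bar>W N \<omega>\<bar> \<le> \<eta> * D" "\<bar>avg (\<lambda>i. W (T i) \<omega>)\<bar> \<le> \<eta> * D"
    using assms(2) D_pos by (simp_all add: power2_le_iff_abs_le)
qed

text \<open>Every term of \<open>G_eq\<close> is measured against \<open>\<delta> \<alpha>\<close>,
  which is at most \<open>n\<close> times the loss. The hypothesis \<open>small\<close> gives
  \<open>R \<alpha> \<le> \<delta> \<alpha> + R \<alpha> / 2\<close>, so the bias dominates the
  risk. The constant 18 adds 8 for the cross term, 4 for the fitted noise and 6 for the training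
  lower bound, without regard to sign.\<close>

lemma G_bound:
  assumes \<alpha>: "\<alpha> \<in> A" and \<eta>: "0 \<le> \<eta>" "\<eta> \<le> 1" and S: "S \<omega> \<le> \<eta>\<^sup>2"
    and small: "2 * (\<sigma>\<^sup>2 * real p) \<le> D"
    and c1: "real p * ln (real n / real (n - k)) \<le> c1 * D" "0 \<le> c1"
    and c2: "avg (\<lambda>i. a_coef n k X (T i) \<alpha>) \<le> c2 * R \<alpha>" "0 \<le> c2"
  shows "\<bar>G \<omega> \<alpha> - shift \<omega> - L \<omega> \<alpha>\<bar> \<le> (18 * \<eta> + 9 * \<phi> + 2 * \<sigma>\<^sup>2 * (c1 + c2)) * L \<omega> \<alpha>"
proof -
  let ?d = "\<delta> \<alpha>" and ?x = "ip N (\<epsilon> \<omega>) (bias \<alpha>)"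
  let ?h = "ip N (noise_fit \<alpha> \<omega>) (noise_fit \<alpha> \<omega>)" and ?ee = "ip N (\<epsilon> \<omega>) (\<epsilon> \<omega>)"
  note Sb = S_bounds[OF S \<eta>(1)]
  have R: "R \<alpha> \<le> 2 * ?d" using R_bounds(2)[OF \<alpha>] small D_le[OF \<alpha>] by linarith
  then have D: "D \<le> 2 * ?d" using D_le[OF \<alpha>] by linarith
  have d: "0 < ?d" by (rule \<delta>_pos[OF \<alpha>])
  have \<phi>: "0 \<le> \<phi>" "\<phi> \<le> 1" using n_pos by auto
  have \<eta>D: "\<eta> * D \<le> 2 * (\<eta> * ?d)" using mult_left_mono[OF D \<eta>(1)] by simp
  have "\<eta>\<^sup>2 * D \<le> \<eta> * D" using mult_right_mono[OF mult_left_mono[OF \<eta>(2,1)], of D] D_pos by (simp add: power2_eq_square)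
  then have \<eta>2D: "\<eta>\<^sup>2 * D \<le> 2 * (\<eta> * ?d)" using \<eta>D by linarith
  have h: "0 \<le> ?h" "?h \<le> 2 * (\<eta> * ?d)"
    using ip_self_nonneg noise_fit_le[OF \<alpha>, of \<omega>] Sb(1) \<eta>2D by (auto intro: order_trans)
  \<comment> \<open>The cross term splits into \<open>W N\<close> and an inner product inside the
    span of all columns; each is at most \<open>2 * (\<eta> * ?d)\<close>.\<close>
  have x: "\<bar>?x\<bar> \<le> 4 * (\<eta> * ?d)"
  proof -
    have "ip N (\<epsilon> \<omega>) (orth_res N (span_dim N) (span_basis N) (bias \<alpha>)) = W N \<omega>"
      unfolding W_def ip_commute[of N _ "\<epsilon> \<omega>"] using \<rho>_bias[OF \<alpha>] by (intro ip_cong) auto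
    then have "(?x - W N \<omega>)\<^sup>2 \<le> ?d * U N \<omega>"
      using ip_minus_res_bound[OF basis(2), of N "\<epsilon> \<omega>" "bias \<alpha>"] by (simp add: \<delta>_def U_def)
    also have "\<dots> \<le> ?d * (\<eta>\<^sup>2 * (2 * ?d))"
      using Sb(1) D d by (intro mult_left_mono order_trans[OF Sb(1)]) auto
    also have "\<dots> \<le> (2 * (\<eta> * ?d))\<^sup>2"
      using zero_le_square[of "\<eta> * ?d"] by (simp add: power2_eq_square algebra_simps)
    finally have "\<bar>?x - W N \<omega>\<bar> \<le> 2 * (\<eta> * ?d)"
      by (rule power2_le_iff_abs_le[THEN iffD1, rotated]) (use \<eta>(1) d in simp)
    then show ?thesis using Sb(3) \<eta>D by linarith
  qed
  \<comment> \<open>Balance turns the averaged upper bounds into \<open>\<phi>\<close> times a full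
    sum, whose error energy cancels; 9 is 1 + 2 * 4, using \<open>\<eta> \<le> 1\<close>.\<close>
  have upper: "avg (\<lambda>i. train_rss i \<omega> \<alpha>) - \<phi> * ?ee \<le> 9 * (\<phi> * ?d)"
  proof -
    have "avg (\<lambda>i. train_rss i \<omega> \<alpha>) \<le> avg (\<lambda>i. ip (T i) (\<lambda>j. bias \<alpha> j + e j \<omega>) (\<lambda>j. bias \<alpha> j + e j \<omega>))"
      by (intro avg_mono train_rss_upper \<alpha>)
    also have "\<dots> = \<phi> * ip N (\<lambda>j. bias \<alpha> j + e j \<omega>) (\<lambda>j. bias \<alpha> j + e j \<omega>)"
      unfolding avg_def by (rule train_avg)
    also have "ip N (\<lambda>j. bias \<alpha> j + e j \<omega>) (\<lambda>j. bias \<alpha> j + e j \<omega>) = ?d + 2 * ?x + ?ee"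
      by (simp add: ip_add_left ip_add_right \<delta>_def ip_commute[of N "bias \<alpha>" "\<epsilon> \<omega>"])
    also have "\<phi> * (?d + 2 * ?x + ?ee) = \<phi> * (?d + 2 * ?x) + \<phi> * ?ee"
      by (simp only: distrib_left)
    finally have "avg (\<lambda>i. train_rss i \<omega> \<alpha>) - \<phi> * ?ee \<le> \<phi> * (?d + 2 * ?x)" by linarith
    also have "\<dots> \<le> \<phi> * (9 * ?d)"
    proof (rule mult_left_mono[OF _ \<phi>(1)])
      have "\<eta> * ?d \<le> ?d" using \<eta> d by simp
      then show "?d + 2 * ?x \<le> 9 * ?d" using x by linarith
    qed
    also have "\<phi> * (9 * ?d) = 9 * (\<phi> * ?d)" by (rule mult.left_commute)
    finally show ?thesis .
  qed
  \<comment> \<open>Averaging the lower bounds cancels the error energy again; 6 is 2 from the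
    \<open>U\<close> average plus 2 * 2 from the \<open>W\<close> average.\<close>
  have lower: "- (6 * (\<eta> * ?d)) \<le> avg (\<lambda>i. train_rss i \<omega> \<alpha>) - \<phi> * ?ee"
  proof -
    have "avg (\<lambda>i. ip (T i) (\<epsilon> \<omega>) (\<epsilon> \<omega>)) = \<phi> * ?ee"
      unfolding avg_def by (rule train_avg)
    moreover have "avg (\<lambda>i. ip (T i) (\<epsilon> \<omega>) (\<epsilon> \<omega>) - U (T i) \<omega> + 2 * W (T i) \<omega>) \<le> avg (\<lambda>i. train_rss i \<omega> \<alpha>)"
      by (intro avg_mono train_rss_lower \<alpha>)
    ultimately have "\<phi> * ?ee - avg (\<lambda>i. U (T i) \<omega>) + 2 * avg (\<lambda>i. W (T i) \<omega>) \<le> avg (\<lambda>i. train_rss i \<omega> \<alpha>)"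
      by (simp add: avg_add avg_diff avg_cmult)
    then show ?thesis using Sb(2,4) \<eta>D \<eta>2D by linarith
  qed
  \<comment> \<open>The bounds \<open>c1\<close> and \<open>c2\<close> are relative to
    \<open>D\<close> and \<open>R \<alpha>\<close>, both at most \<open>2 * ?d\<close>, whence the
    factor 2.\<close>
  have log: "0 \<le> \<sigma>\<^sup>2 * avg (log_ratio \<alpha>)" "\<sigma>\<^sup>2 * avg (log_ratio \<alpha>) \<le> 2 * \<sigma>\<^sup>2 * (c1 + c2) * ?d"
  proof -
    show "0 \<le> \<sigma>\<^sup>2 * avg (log_ratio \<alpha>)"
      by (intro mult_nonneg_nonneg avg_nonneg log_ratio_nonneg \<alpha>) auto
    have "avg (log_ratio \<alpha>) = avg (\<lambda>i. a_coef n k X (T i) \<alpha> + real (card \<alpha>) * ln (real n / real (n - k)))"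
      unfolding avg_def using log_ratio_eq[OF \<alpha>] by simp
    also have "\<dots> = avg (\<lambda>i. a_coef n k X (T i) \<alpha>) + real (card \<alpha>) * ln (real n / real (n - k))"
      by (simp add: avg_add avg_const)
    also have "\<dots> \<le> c2 * R \<alpha> + c1 * D"
    proof (rule add_mono[OF c2(1)])
      have "card \<alpha> \<le> p" using models[OF \<alpha>] card_mono[of "{..<p}" \<alpha>] by simp
      moreover have "0 \<le> ln (real n / real (n - k))" using k_range by simp
      ultimately have "real (card \<alpha>) * ln (real n / real (n - k)) \<le> real p * ln (real n / real (n - k))"
        by (intro mult_right_mono) auto
      then show "real (card \<alpha>) * ln (real n / real (n - k)) \<le> c1 * D" using c1(1) by linarith
    qed
    also have "\<dots> \<le> c2 * (2 * ?d) + c1 * (2 * ?d)"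
      using R D c1(2) c2(2) by (intro add_mono mult_left_mono)
    finally have "\<sigma>\<^sup>2 * avg (log_ratio \<alpha>) \<le> \<sigma>\<^sup>2 * (c2 * (2 * ?d) + c1 * (2 * ?d))"
      by (intro mult_left_mono) auto
    then show "\<sigma>\<^sup>2 * avg (log_ratio \<alpha>) \<le> 2 * \<sigma>\<^sup>2 * (c1 + c2) * ?d"
      by (simp add: algebra_simps)
  qed
  let ?c = "18 * \<eta> + 9 * \<phi> + 2 * \<sigma>\<^sup>2 * (c1 + c2)"
  have cd: "?c * ?d = 18 * (\<eta> * ?d) + 9 * (\<phi> * ?d) + 2 * \<sigma>\<^sup>2 * (c1 + c2) * ?d"
    by (simp only: distrib_right mult.assoc)
  have nn: "0 \<le> \<phi> * ?d" "0 \<le> \<eta> * ?d" using \<phi>(1) \<eta>(1) d by auto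
  have "\<bar>real n * (G \<omega> \<alpha> - shift \<omega> - L \<omega> \<alpha>)\<bar> \<le> ?c * ?d"
    unfolding G_eq[OF \<alpha>] cd using x h upper lower log nn by linarith
  also have "\<dots> \<le> ?c * (real n * L \<omega> \<alpha>)"
    using n_L_ge[OF \<alpha>, of \<omega>] \<eta>(1) \<phi>(1) c1(2) c2(2) by (intro mult_left_mono) auto
  finally have "real n * \<bar>G \<omega> \<alpha> - shift \<omega> - L \<omega> \<alpha>\<bar> \<le> real n * (?c * L \<omega> \<alpha>)"
    by (simp add: abs_mult mult.left_commute)
  then show ?thesis using n_pos by simp
qed

text \<open>Where \<open>S\<close> is below \<open>\<eta>\<^sup>2\<close>, \<open>G_bound\<close>
  holds for all models simultaneously. The exceptional event does not involve the model, so Markov's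
  inequality for \<open>S\<close> alone suffices.\<close>

lemma deviation_prob_bound:
  assumes \<eta>: "0 < \<eta>" "\<eta> \<le> 1"
    and small: "2 * (\<sigma>\<^sup>2 * real p) \<le> D"
    and c1: "real p * ln (real n / real (n - k)) \<le> c1 * D" "0 \<le> c1"
    and c2: "\<And>\<alpha>. \<alpha> \<in> A \<Longrightarrow> avg (\<lambda>i. a_coef n k X (T i) \<alpha>) \<le> c2 * R \<alpha>" "0 \<le> c2"
    and t: "18 * \<eta> + 9 * \<phi> + 2 * \<sigma>\<^sup>2 * (c1 + c2) \<le> t"
  shows "measure M {\<omega> \<in> space M. deviation \<omega> > t} \<le> 4 * \<sigma>\<^sup>2 * (real p / D) / \<eta>\<^sup>2"
proof -
  have "deviation \<omega> \<le> t" if "S \<omega> < \<eta>\<^sup>2" for \<omega>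
  proof -
    have "\<bar>G \<omega> \<alpha> - shift \<omega> - L \<omega> \<alpha>\<bar> / L \<omega> \<alpha> \<le> t" if "\<alpha> \<in> A" for \<alpha>
    proof -
      have "\<bar>G \<omega> \<alpha> - shift \<omega> - L \<omega> \<alpha>\<bar> \<le> (18 * \<eta> + 9 * \<phi> + 2 * \<sigma>\<^sup>2 * (c1 + c2)) * L \<omega> \<alpha>"
        using \<eta> \<open>S \<omega> < \<eta>\<^sup>2\<close> by (intro G_bound that small c1 c2) auto
      also have "\<dots> \<le> t * L \<omega> \<alpha>"
        using L_pos[OF that, of \<omega>] t by (intro mult_right_mono) auto
      finally show ?thesis using L_pos[OF that, of \<omega>] by (simp add: pos_divide_le_eq)
    qed
    then show ?thesis unfolding deviation_def using finite_A models_nonempty by simp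
  qed
  then have sub: "{\<omega> \<in> space M. deviation \<omega> > t} \<subseteq> {\<omega> \<in> space M. S \<omega> \<ge> \<eta>\<^sup>2}"
    by (intro Collect_mono) (metis not_le)
  have [measurable]: "S \<in> borel_measurable M" using S_moment(1) by simp
  have "measure M {\<omega> \<in> space M. deviation \<omega> > t} \<le> measure M {\<omega> \<in> space M. S \<omega> \<ge> \<eta>\<^sup>2}"
    by (rule finite_measure_mono[OF sub]) measurable
  also have "\<dots> \<le> expectation S / \<eta>\<^sup>2"
    using \<eta> by (intro integral_Markov_inequality_measure[OF S_moment(1), of "{}"]) (auto simp: S_nonneg)
  also have "\<dots> \<le> 4 * \<sigma>\<^sup>2 * (real p / D) / \<eta>\<^sup>2"
    by (intro divide_right_mono S_moment) auto
  finally show ?thesis .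
qed

section \<open>Measurability of the loss and of the deviation\<close>

lemma L_measurable [measurable]:
  assumes "\<alpha> \<in> A"
  shows "(\<lambda>\<omega>. L \<omega> \<alpha>) \<in> borel_measurable M"
proof -
  have "(\<lambda>\<omega>. L \<omega> \<alpha>) = (\<lambda>\<omega>. (\<delta> \<alpha> + ip N (noise_fit \<alpha> \<omega>) (noise_fit \<alpha> \<omega>)) / real n)"
    using n_L[OF assms] n_pos by (simp add: fun_eq_iff field_simps)
  then show ?thesis using noise_fit_measurable[OF assms] by (simp add: ip_def)
qed

lemma Y_measurable: "j < n \<Longrightarrow> (\<lambda>\<omega>. vec_index (Y \<omega>) j) \<in> borel_measurable M"
  by (simp add: Y_index cong: measurable_cong)

lemma train_rss_measurable:
  assumes "\<alpha> \<in> A" "i < r"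
  shows "(\<lambda>\<omega>. train_rss i \<omega> \<alpha>) \<in> borel_measurable M"
proof -
  have [measurable]: "(\<lambda>\<omega>. subdesign.fit X (T i) \<alpha> (Y \<omega>) j) \<in> borel_measurable M" for j
    by (rule subdesign.fit_measurable[OF train_subdesign[OF assms(2,1)] Y_carrier Y_measurable])
  have "(\<lambda>\<omega>. vec_index (Y \<omega>) j) \<in> borel_measurable M" if "j \<in> T i" for j
    using train[OF assms(2)] that by (intro Y_measurable) auto
  then show ?thesis unfolding train_rss_eq[OF assms] ip_def by measurable
qed

text \<open>\<open>G_eq\<close> expresses the difference through finitely many measurable terms; the
  determinant term is not random.\<close>

lemma G_deviation_measurable:
  assumes "\<alpha> \<in> A"
  shows "(\<lambda>\<omega>. G \<omega> \<alpha> - shift \<omega> - L \<omega> \<alpha>) \<in> borel_measurable M"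
proof -
  have "(\<lambda>\<omega>. G \<omega> \<alpha> - shift \<omega> - L \<omega> \<alpha>) = (\<lambda>\<omega>. (2 * ip N (\<epsilon> \<omega>) (bias \<alpha>) - 2 * ip N (noise_fit \<alpha> \<omega>) (noise_fit \<alpha> \<omega>)
    - (avg (\<lambda>i. train_rss i \<omega> \<alpha>) - \<phi> * ip N (\<epsilon> \<omega>) (\<epsilon> \<omega>)) + \<sigma>\<^sup>2 * avg (log_ratio \<alpha>)) / real n)"
    using G_eq[OF assms] n_pos by (simp add: fun_eq_iff field_simps)
  then show ?thesis
    using noise_fit_measurable[OF assms] train_rss_measurable[OF assms] by (simp add: ip_def avg_def)
qed

lemma deviation_measurable: "deviation \<in> borel_measurable M"
  unfolding deviation_def[abs_def] using finite_A G_deviation_measurable L_measurable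
  by (intro borel_measurable_Max borel_measurable_divide borel_measurable_abs) auto

text \<open>The shift is common to all models, so comparing the minimiser \<open>\<beta>\<close> of
  the criterion with a minimiser \<open>\<gamma>\<close> of the loss gives \<open>(1 - \<tau>) * L
  \<omega> \<beta> \<le> (1 + \<tau>) * L \<omega> \<gamma>\<close>.\<close>

lemma selected_ratio:
  assumes min: "is_arg_min (G \<omega>) (\<lambda>\<alpha>. \<alpha> \<in> A) \<beta>" and \<tau>: "deviation \<omega> \<le> \<tau>" "\<tau> \<le> 1/2"
  shows "\<bar>L \<omega> \<beta> / (MIN \<alpha>\<in>A. L \<omega> \<alpha>) - 1\<bar> \<le> 4 * \<tau>"
proof -
  have dev: "\<bar>G \<omega> \<alpha> - shift \<omega> - L \<omega> \<alpha>\<bar> \<le> \<tau> * L \<omega> \<alpha>" if "\<alpha> \<in> A" for \<alpha>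
  proof -
    have "\<bar>G \<omega> \<alpha> - shift \<omega> - L \<omega> \<alpha>\<bar> / L \<omega> \<alpha> \<le> deviation \<omega>"
      unfolding deviation_def using finite_A that by (intro Max_ge) auto
    then show ?thesis using \<tau>(1) L_pos[OF that, of \<omega>] by (simp add: pos_divide_le_eq[symmetric])
  qed
  have \<beta>: "\<beta> \<in> A" using min by (simp add: is_arg_min_def)
  let ?m = "MIN \<alpha>\<in>A. L \<omega> \<alpha>"
  have "?m \<in> L \<omega> ` A" using finite_A models_nonempty by (intro Min_in) auto
  then obtain \<gamma> where \<gamma>: "\<gamma> \<in> A" "?m = L \<omega> \<gamma>" by blast
  have m_pos: "0 < ?m" using L_pos[OF \<gamma>(1)] \<gamma>(2) by simp
  have le: "?m \<le> L \<omega> \<beta>" using finite_A \<beta> by simp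
  have \<tau>0: "0 \<le> \<tau>" using dev[OF \<beta>] L_pos[OF \<beta>, of \<omega>]
    by (metis abs_ge_zero order_trans zero_le_mult_iff not_less)
  have "G \<omega> \<beta> \<le> G \<omega> \<gamma>" using min \<gamma>(1) by (auto simp: is_arg_min_def not_less)
  then have "(1 - \<tau>) * L \<omega> \<beta> \<le> (1 + \<tau>) * ?m"
    using dev[OF \<beta>] dev[OF \<gamma>(1)] unfolding \<gamma>(2) left_diff_distrib distrib_right by linarith
  also have "\<dots> \<le> (1 - \<tau>) * ((1 + 4 * \<tau>) * ?m)"
  proof -
    \<comment> \<open>After expansion this is \<open>4 * \<tau>\<^sup>2 \<le> 2 * \<tau>\<close>,
      which is where the bound 1/2 on \<open>\<tau>\<close> comes from.\<close>
    have "1 + \<tau> \<le> (1 - \<tau>) * (1 + 4 * \<tau>)"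
      using mult_left_mono[OF \<tau>(2) \<tau>0] by (simp add: algebra_simps)
    then show ?thesis using m_pos by (simp add: mult.assoc[symmetric])
  qed
  finally have "L \<omega> \<beta> \<le> (1 + 4 * \<tau>) * ?m" using \<tau>(2) by simp
  then have "L \<omega> \<beta> / ?m \<le> 1 + 4 * \<tau>" using m_pos by (simp add: pos_divide_le_eq)
  moreover have "1 \<le> L \<omega> \<beta> / ?m" using m_pos le by simp
  ultimately show ?thesis by simp
qed

end

section \<open>Asymptotics\<close>

context cv_setting
begin

lemma deviation_nonneg: "0 \<le> deviation \<omega>"
proof -
  obtain \<alpha> where \<alpha>: "\<alpha> \<in> A" using models_nonempty by blast
  have "0 \<le> \<bar>G \<omega> \<alpha> - shift \<omega> - L \<omega> \<alpha>\<bar> / L \<omega> \<alpha>"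
    using L_pos[OF \<alpha>, of \<omega>] by simp
  also have "\<dots> \<le> deviation \<omega>"
    unfolding deviation_def using finite_A \<alpha> by (intro Max_ge) auto
  finally show ?thesis .
qed

text \<open>\<open>c1\<close> is the ratio in condition (ii) and \<open>c2\<close> the absolute
  value of the maximum in (iii), which may be negative while a nonnegative bound is wanted. Once the
  logarithm is at least 1, \<open>p / D\<close> is at most \<open>c1\<close>, so (ii) supplies both
  the dominance of the bias and the Markov bound.\<close>

lemma deviation_prob_bound_of_conditions:
  fixes c1 c2 :: real
  defines "c1 \<equiv> real p * ln (real n / real (n - k)) / D"
    and "c2 \<equiv> \<bar>MAX \<alpha>\<in>A. avg (\<lambda>i. a_coef n k X (T i) \<alpha>) / R \<alpha>\<bar>"
  assumes \<eta>: "0 < \<eta>" "\<eta> \<le> 1"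
    and \<lambda>: "1 \<le> ln (real n / real (n - k))"
    and small: "2 * \<sigma>\<^sup>2 * c1 \<le> 1"
    and t: "18 * \<eta> + 9 * \<phi> + 2 * \<sigma>\<^sup>2 * (c1 + c2) \<le> t"
  shows "measure M {\<omega> \<in> space M. deviation \<omega> > t} \<le> 4 * \<sigma>\<^sup>2 * c1 / \<eta>\<^sup>2"
proof -
  have pD: "real p / D \<le> c1"
    unfolding c1_def using D_pos mult_left_mono[OF \<lambda>, of "real p"] by (intro divide_right_mono) auto
  have "measure M {\<omega> \<in> space M. deviation \<omega> > t} \<le> 4 * \<sigma>\<^sup>2 * (real p / D) / \<eta>\<^sup>2"
  proof (rule deviation_prob_bound[OF \<eta>, where ?c1.0 = c1 and ?c2.0 = c2])
    have "2 * \<sigma>\<^sup>2 * (real p / D) \<le> 1"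
      using mult_left_mono[OF pD, of "2 * \<sigma>\<^sup>2"] small by simp
    then show "2 * (\<sigma>\<^sup>2 * real p) \<le> D" using D_pos by (simp add: field_simps)
    show "real p * ln (real n / real (n - k)) \<le> c1 * D" using D_pos by (simp add: c1_def)
    show "0 \<le> c1" using pD D_pos by (auto intro: order_trans[rotated])
    show "avg (\<lambda>i. a_coef n k X (T i) \<alpha>) \<le> c2 * R \<alpha>" if "\<alpha> \<in> A" for \<alpha>
    proof -
      have R: "0 < R \<alpha>" using D_pos D_le[OF that] by simp
      have "avg (\<lambda>i. a_coef n k X (T i) \<alpha>) / R \<alpha> \<le> (MAX \<alpha>\<in>A. avg (\<lambda>i. a_coef n k X (T i) \<alpha>) / R \<alpha>)"
        using finite_A that by (intro Max_ge) auto
      then have "avg (\<lambda>i. a_coef n k X (T i) \<alpha>) / R \<alpha> \<le> c2" unfolding c2_def by linarith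
      then show ?thesis using R by (simp add: pos_divide_le_eq)
    qed
    show "0 \<le> c2" by (simp add: c2_def)
  qed (rule t)
  also have "\<dots> \<le> 4 * \<sigma>\<^sup>2 * c1 / \<eta>\<^sup>2"
    using pD by (intro divide_right_mono mult_left_mono) auto
  finally show ?thesis .
qed

end

text \<open>Squeeze between 0 and a null sequence, which may depend on
  \<open>\<epsilon>\<close>.\<close>

lemma tendsto_in_prob_dominated:
  assumes meas: "\<forall>\<^sub>F n in sequentially. Z n \<in> borel_measurable M"
    and dom: "\<And>\<epsilon>. \<epsilon> > 0 \<Longrightarrow> \<exists>b. b \<longlonglongrightarrow> 0 \<and>
      (\<forall>\<^sub>F n in sequentially. measure M {\<omega> \<in> space M. \<bar>Z n \<omega> - c\<bar> > \<epsilon>} \<le> b n)"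
  shows "tendsto_in_prob M Z c"
  unfolding tendsto_in_prob_def
proof (intro conjI allI impI)
  fix \<epsilon> :: real assume "\<epsilon> > 0"
  from dom[OF this] obtain b where b: "b \<longlonglongrightarrow> 0"
    "\<forall>\<^sub>F n in sequentially. measure M {\<omega> \<in> space M. \<bar>Z n \<omega> - c\<bar> > \<epsilon>} \<le> b n"
    by blast
  show "(\<lambda>n. measure M {\<omega> \<in> space M. \<bar>Z n \<omega> - c\<bar> > \<epsilon>}) \<longlonglongrightarrow> 0"
    by (rule real_tendsto_sandwich[OF _ b(2) tendsto_const b(1)]) simp
qed (rule meas)

text \<open>Sample sizes start at 2 because \<open>1 \<le> k \<and> k < n\<close> has no solution
  below.\<close>

theorem theorem2p1:
  fixes M :: "'a measure"
    and e :: "nat \<Rightarrow> 'a \<Rightarrow> real"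
    and \<sigma> :: real
    and \<mu> :: "nat \<Rightarrow> real Matrix.vec"
    and X :: "nat \<Rightarrow> real Matrix.mat"
    and p k r :: "nat \<Rightarrow> nat"
    and A :: "nat \<Rightarrow> nat set set"
    and T :: "nat \<Rightarrow> nat \<Rightarrow> nat set"
    and m :: nat
  defines "Y \<equiv> \<lambda>n \<omega>. \<mu> n + err_vec e n \<omega>"
  defines "L \<equiv> \<lambda>n \<alpha> \<omega>. loss n (X n) (\<mu> n) (Y n \<omega>) \<alpha>"
  defines "R \<equiv> \<lambda>n \<alpha>. risk M e n (X n) (\<mu> n) \<alpha>"
  defines "\<Gamma> \<equiv> \<lambda>n \<alpha> \<omega>. crit n (\<sigma>\<^sup>2) (X n) (r n) (T n) (Y n \<omega>) \<alpha>"
  assumes prob: "prob_space M"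
    and indep: "prob_space.indep_vars M (\<lambda>_. borel) e UNIV"
    and sq_int: "\<And>j. integrable M (\<lambda>\<omega>. (e j \<omega>)\<^sup>2)"
    and mean: "\<And>j. prob_space.expectation M (e j) = 0"
    and var: "\<And>j. prob_space.variance M (e j) = \<sigma>\<^sup>2"
    and mu_dim: "\<And>n. n \<ge> 2 \<Longrightarrow> \<mu> n \<in> carrier_vec n"
    and X_dim: "\<And>n. n \<ge> 2 \<Longrightarrow> X n \<in> carrier_mat n (p n)"
    and models_nonempty: "\<And>n. n \<ge> 2 \<Longrightarrow> A n \<noteq> {}"
    and models: "\<And>n \<alpha>. n \<ge> 2 \<Longrightarrow> \<alpha> \<in> A n \<Longrightarrow> \<alpha> \<noteq> {} \<and> \<alpha> \<subseteq> {..<p n}"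
    and incorrect: "\<And>n \<alpha>. n \<ge> 2 \<Longrightarrow> \<alpha> \<in> A n \<Longrightarrow> \<mu> n \<notin> vec_space.col_space n (design (X n) \<alpha>)"
    and k_range: "\<And>n. n \<ge> 2 \<Longrightarrow> 1 \<le> k n \<and> k n < n"
    and r_pos: "\<And>n. n \<ge> 2 \<Longrightarrow> r n \<ge> 1"
    and train: "\<And>n i. n \<ge> 2 \<Longrightarrow> i < r n \<Longrightarrow> T n i \<subseteq> {..<n} \<and> card (T n i) = n - k n"
    and balanced: "\<And>n. n \<ge> 2 \<Longrightarrow> \<exists>c. \<forall>j<n. card {i. i < r n \<and> j \<in> T n i} = c"
    and nonsing: "\<And>n i \<alpha>. n \<ge> 2 \<Longrightarrow> i < r n \<Longrightarrow> \<alpha> \<in> A n \<Longrightarrow>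
                    invertible_mat (gram (train_design (X n) (T n i) \<alpha>))"
    and train_large: "filterlim (\<lambda>n. n - k n) at_top sequentially"
    and train_frac: "(\<lambda>n. real (n - k n) / real n) \<longlonglongrightarrow> 0"
    and m_pos: "m > 0"
    and moment: "integrable M (\<lambda>\<omega>. e 0 \<omega> ^ (4 * m))"
    and cond_i: "(\<lambda>n. \<Sum>\<alpha>\<in>A n. 1 / (real n * R n \<alpha>) ^ m) \<longlonglongrightarrow> 0"
    and cond_ii: "(\<lambda>n. real (p n) * ln (real n / real (n - k n)) /
                       (MIN \<alpha>\<in>A n. real n * R n \<alpha>)) \<longlonglongrightarrow> 0"
    and cond_iii: "(\<lambda>n. MAX \<alpha>\<in>A n.
                       ((\<Sum>i<r n. a_coef n (k n) (X n) (T n i) \<alpha>) / real (r n)) /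
                       (real n * R n \<alpha>)) \<longlonglongrightarrow> 0"
  shows "tendsto_in_prob M
           (\<lambda>n \<omega>. MAX \<alpha>\<in>A n.
              \<bar>\<Gamma> n \<alpha> \<omega> - real (k n) / (real n)\<^sup>2 * sq_norm (err_vec e n \<omega>) - L n \<alpha> \<omega>\<bar> / L n \<alpha> \<omega>) 0
       \<and> (\<forall>\<alpha>hat :: nat \<Rightarrow> 'a \<Rightarrow> nat set.
            (\<forall>n\<ge>2. \<alpha>hat n \<in> measurable M (count_space (A n)) \<and>
                    (\<forall>\<omega>\<in>space M. is_arg_min (\<lambda>\<alpha>. \<Gamma> n \<alpha> \<omega>) (\<lambda>\<alpha>. \<alpha> \<in> A n) (\<alpha>hat n \<omega>)))
            \<longrightarrow> tendsto_in_prob M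
                  (\<lambda>n \<omega>. L n (\<alpha>hat n \<omega>) \<omega> / (MIN \<alpha>\<in>A n. L n \<alpha> \<omega>)) 1)"
proof -
  interpret prob_space M by (rule prob)
  interpret white_noise M e \<sigma>
    using indep sq_int mean var by (rule white_noise_indep)
  \<comment> \<open>Every sample size from 2 on is an instance of the fixed-size setting, with the
    error sequence shared by all of them.\<close>
  have cv: "cv_setting M e \<sigma> n (p n) (k n) (r n) (X n) (\<mu> n) (A n) (T n)" if "n \<ge> 2" for n
    using that mu_dim[OF that] X_dim[OF that] models_nonempty[OF that] models[OF that] incorrect[OF that]
      k_range[OF that] r_pos[OF that] train[OF that] balanced[OF that] nonsing[OF that]
    by unfold_locales auto
  define Z where "Z n \<omega> = (MAX \<alpha>\<in>A n.
    \<bar>\<Gamma> n \<alpha> \<omega> - real (k n) / (real n)\<^sup>2 * sq_norm (err_vec e n \<omega>) - L n \<alpha> \<omega>\<bar> / L n \<alpha> \<omega>)" for n \<omega>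
  define c1 where "c1 n = real (p n) * ln (real n / real (n - k n)) / (MIN \<alpha>\<in>A n. real n * R n \<alpha>)" for n
  define c2 where "c2 n = \<bar>MAX \<alpha>\<in>A n.
    ((\<Sum>i<r n. a_coef n (k n) (X n) (T n i) \<alpha>) / real (r n)) / (real n * R n \<alpha>)\<bar>" for n
  define \<phi> where "\<phi> n = real (n - k n) / real n" for n
  have lims: "c1 \<longlonglongrightarrow> 0" "c2 \<longlonglongrightarrow> 0" "\<phi> \<longlonglongrightarrow> 0"
    using cond_ii tendsto_rabs_zero[OF cond_iii] train_frac by (simp_all add: c1_def[abs_def] c2_def[abs_def] \<phi>_def[abs_def])
  have Z_meas: "Z n \<in> borel_measurable M" and Z_nonneg: "0 \<le> Z n \<omega>" if "n \<ge> 2" for n \<omega>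
  proof -
    interpret c: cv_setting M e \<sigma> n "p n" "k n" "r n" "X n" "\<mu> n" "A n" "T n" by (rule cv[OF that])
    have "Z n = c.deviation"
      by (simp add: Z_def[abs_def] c.deviation_def[abs_def] c.G_def c.L_def c.shift_def \<Gamma>_def L_def Y_def)
    then show "Z n \<in> borel_measurable M" "0 \<le> Z n \<omega>"
      using c.deviation_measurable c.deviation_nonneg by auto
  qed
  have Z_bound: "measure M {\<omega> \<in> space M. Z n \<omega> > t} \<le> 4 * \<sigma>\<^sup>2 * c1 n / \<eta>\<^sup>2"
    if "n \<ge> 2" "0 < \<eta>" "\<eta> \<le> 1" "1 \<le> ln (real n / real (n - k n))" "2 * \<sigma>\<^sup>2 * c1 n \<le> 1"
      "18 * \<eta> + 9 * \<phi> n + 2 * \<sigma>\<^sup>2 * (c1 n + c2 n) \<le> t" for n \<eta> t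
  proof -
    interpret c: cv_setting M e \<sigma> n "p n" "k n" "r n" "X n" "\<mu> n" "A n" "T n" by (rule cv[OF that(1)])
    have Z: "Z n = c.deviation"
      by (simp add: Z_def[abs_def] c.deviation_def[abs_def] c.G_def c.L_def c.shift_def \<Gamma>_def L_def Y_def)
    have c1: "c1 n = real (p n) * ln (real n / real (n - k n)) / c.D"
      by (simp add: c1_def c.D_def c.R_def R_def)
    have c2: "c2 n = \<bar>MAX \<alpha>\<in>A n. c.avg (\<lambda>i. a_coef n (k n) (X n) (T n i) \<alpha>) / c.R \<alpha>\<bar>"
      by (simp add: c2_def c.avg_def c.R_def R_def)
    show ?thesis unfolding Z c1
      by (rule c.deviation_prob_bound_of_conditions)
         (use that in \<open>simp_all only: c1 c2 \<phi>_def\<close>)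
  qed
  \<comment> \<open>Eventually the training fraction is below \<open>exp (- 1)\<close>, so its
    reciprocal exceeds \<open>exp 1\<close>.\<close>
  have log_large: "\<forall>\<^sub>F n in sequentially. 1 \<le> ln (real n / real (n - k n))"
  proof -
    have "\<forall>\<^sub>F n in sequentially. \<phi> n < exp (- 1)"
      using lims(3) by (rule order_tendstoD) simp
    moreover have "\<forall>\<^sub>F n in sequentially. n \<ge> 2" by (rule eventually_ge_at_top)
    ultimately show ?thesis
    proof eventually_elim
      case (elim n)
      then have pos: "0 < real n" "0 < real (n - k n)" using k_range[of n] by auto
      then have "exp 1 \<le> real n / real (n - k n)"
        using elim(1) by (simp add: \<phi>_def exp_minus field_simps)
      then have "ln (exp 1) \<le> ln (real n / real (n - k n))"
        using pos by (subst ln_le_cancel_iff) auto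
      then show ?case by simp
    qed
  qed
  have Z_tail: "\<exists>b. b \<longlonglongrightarrow> 0 \<and> (\<forall>\<^sub>F n in sequentially. measure M {\<omega> \<in> space M. Z n \<omega> > \<epsilon>} \<le> b n)"
    if "\<epsilon> > 0" for \<epsilon>
  proof (intro exI conjI)
    \<comment> \<open>Half of \<open>\<epsilon>\<close> pays for \<open>18 * \<eta>\<close>, the
      other half for the null sequences in \<open>Z_bound\<close>. As \<open>\<eta>\<close> stays
      fixed while \<open>n\<close> grows, the Markov bound still tends to 0.\<close>
    define \<eta> where "\<eta> = min 1 (\<epsilon> / 36)"
    have \<eta>: "0 < \<eta>" "\<eta> \<le> 1" "18 * \<eta> \<le> \<epsilon> / 2" using that by (auto simp: \<eta>_def min_def)
    have "(\<lambda>n. 4 * \<sigma>\<^sup>2 * c1 n / \<eta>\<^sup>2) \<longlonglongrightarrow> 4 * \<sigma>\<^sup>2 * 0 / \<eta>\<^sup>2"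
      using lims(1) \<eta>(1) by (intro tendsto_intros) auto
    then show "(\<lambda>n. 4 * \<sigma>\<^sup>2 * c1 n / \<eta>\<^sup>2) \<longlonglongrightarrow> 0" by simp
    have "(\<lambda>n. 9 * \<phi> n + 2 * \<sigma>\<^sup>2 * (c1 n + c2 n)) \<longlonglongrightarrow> 9 * 0 + 2 * \<sigma>\<^sup>2 * (0 + 0)"
      by (intro tendsto_intros lims)
    then have "\<forall>\<^sub>F n in sequentially. 9 * \<phi> n + 2 * \<sigma>\<^sup>2 * (c1 n + c2 n) < \<epsilon> / 2"
      by (rule order_tendstoD) (use that in simp)
    moreover have "(\<lambda>n. 2 * \<sigma>\<^sup>2 * c1 n) \<longlonglongrightarrow> 2 * \<sigma>\<^sup>2 * 0"
      by (intro tendsto_intros lims)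
    then have "\<forall>\<^sub>F n in sequentially. 2 * \<sigma>\<^sup>2 * c1 n < 1"
      by (rule order_tendstoD) simp
    moreover have "\<forall>\<^sub>F n in sequentially. n \<ge> 2" by (rule eventually_ge_at_top)
    ultimately show "\<forall>\<^sub>F n in sequentially. measure M {\<omega> \<in> space M. Z n \<omega> > \<epsilon>} \<le> 4 * \<sigma>\<^sup>2 * c1 n / \<eta>\<^sup>2"
      using log_large by eventually_elim (rule Z_bound, use \<eta> in auto)
  qed
  have ge2: "\<forall>\<^sub>F n in sequentially. n \<ge> 2" by (rule eventually_ge_at_top)
  have "tendsto_in_prob M Z 0"
  proof (rule tendsto_in_prob_dominated)
    show "\<forall>\<^sub>F n in sequentially. Z n \<in> borel_measurable M"
      using ge2 by eventually_elim (rule Z_meas)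
    fix \<epsilon> :: real assume "\<epsilon> > 0"
    from Z_tail[OF this] obtain b where b: "b \<longlonglongrightarrow> 0"
      "\<forall>\<^sub>F n in sequentially. measure M {\<omega> \<in> space M. Z n \<omega> > \<epsilon>} \<le> b n" by blast
    from b(2) ge2 have "\<forall>\<^sub>F n in sequentially. measure M {\<omega> \<in> space M. \<bar>Z n \<omega> - 0\<bar> > \<epsilon>} \<le> b n"
      by eventually_elim (simp add: Z_nonneg)
    with b(1) show "\<exists>b. b \<longlonglongrightarrow> 0 \<and>
      (\<forall>\<^sub>F n in sequentially. measure M {\<omega> \<in> space M. \<bar>Z n \<omega> - 0\<bar> > \<epsilon>} \<le> b n)" by blast
  qed
  moreover have "tendsto_in_prob M (\<lambda>n \<omega>. L n (\<alpha>hat n \<omega>) \<omega> / (MIN \<alpha>\<in>A n. L n \<alpha> \<omega>)) 1"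
    if sel: "\<forall>n\<ge>2. \<alpha>hat n \<in> measurable M (count_space (A n)) \<and>
      (\<forall>\<omega>\<in>space M. is_arg_min (\<lambda>\<alpha>. \<Gamma> n \<alpha> \<omega>) (\<lambda>\<alpha>. \<alpha> \<in> A n) (\<alpha>hat n \<omega>))"
    for \<alpha>hat :: "nat \<Rightarrow> 'a \<Rightarrow> nat set"
  proof (rule tendsto_in_prob_dominated)
    let ?Q = "\<lambda>n \<omega>. L n (\<alpha>hat n \<omega>) \<omega> / (MIN \<alpha>\<in>A n. L n \<alpha> \<omega>)"
    have Q: "?Q n \<in> borel_measurable M"
      "\<And>\<omega> \<tau>. \<omega> \<in> space M \<Longrightarrow> Z n \<omega> \<le> \<tau> \<Longrightarrow> \<tau> \<le> 1/2 \<Longrightarrow> \<bar>?Q n \<omega> - 1\<bar> \<le> 4 * \<tau>" if "n \<ge> 2" for n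
    proof -
      interpret c: cv_setting M e \<sigma> n "p n" "k n" "r n" "X n" "\<mu> n" "A n" "T n" by (rule cv[OF that])
      have Z: "Z n = c.deviation"
        by (simp add: Z_def[abs_def] c.deviation_def[abs_def] c.G_def c.L_def c.shift_def \<Gamma>_def L_def Y_def)
      have L: "L n \<alpha> \<omega> = c.L \<omega> \<alpha>" and \<Gamma>: "\<Gamma> n \<alpha> \<omega> = c.G \<omega> \<alpha>" for \<alpha> \<omega>
        by (simp_all add: L_def c.L_def \<Gamma>_def c.G_def Y_def)
      \<comment> \<open>The selected model takes values in the finite set \<open>A n\<close>, so its
        loss is pasted together from finitely many measurable functions on measurable
        pieces.\<close>
      have "(\<lambda>\<omega>. c.L \<omega> (\<alpha>hat n \<omega>)) \<in> borel_measurable M"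
        using sel that
        by (intro measurable_compose_countable'[OF c.L_measurable _ countable_finite[OF c.finite_A]]) simp_all
      moreover have "(\<lambda>\<omega>. MIN \<alpha>\<in>A n. c.L \<omega> \<alpha>) \<in> borel_measurable M"
        by (intro borel_measurable_Min c.finite_A c.L_measurable)
      ultimately show "?Q n \<in> borel_measurable M" unfolding L by measurable
      show "\<bar>?Q n \<omega> - 1\<bar> \<le> 4 * \<tau>" if "\<omega> \<in> space M" "Z n \<omega> \<le> \<tau>" "\<tau> \<le> 1/2" for \<omega> \<tau>
      proof -
        have "is_arg_min (\<lambda>\<alpha>. \<Gamma> n \<alpha> \<omega>) (\<lambda>\<alpha>. \<alpha> \<in> A n) (\<alpha>hat n \<omega>)"
          using sel \<open>n \<ge> 2\<close> that(1) by blast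
        then show ?thesis
          unfolding L \<Gamma> by (rule c.selected_ratio) (use that Z in auto)
      qed
    qed
    show "\<forall>\<^sub>F n in sequentially. ?Q n \<in> borel_measurable M"
      using ge2 by eventually_elim (rule Q)
    fix \<epsilon> :: real assume "\<epsilon> > 0"
    \<comment> \<open>\<open>selected_ratio\<close> requires a threshold of at most 1/2 and loses a
      factor 4.\<close>
    define \<tau> where "\<tau> = min (\<epsilon> / 4) (1/2)"
    have \<tau>: "0 < \<tau>" "\<tau> \<le> 1/2" "4 * \<tau> \<le> \<epsilon>" using \<open>\<epsilon> > 0\<close> by (auto simp: \<tau>_def)
    from Z_tail[OF \<tau>(1)] obtain b where b: "b \<longlonglongrightarrow> 0"
      "\<forall>\<^sub>F n in sequentially. measure M {\<omega> \<in> space M. Z n \<omega> > \<tau>} \<le> b n" by blast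
    from b(2) ge2 have "\<forall>\<^sub>F n in sequentially. measure M {\<omega> \<in> space M. \<bar>?Q n \<omega> - 1\<bar> > \<epsilon>} \<le> b n"
    proof eventually_elim
      case (elim n)
      have [measurable]: "Z n \<in> borel_measurable M" by (rule Z_meas[OF elim(2)])
      have "measure M {\<omega> \<in> space M. \<bar>?Q n \<omega> - 1\<bar> > \<epsilon>} \<le> measure M {\<omega> \<in> space M. Z n \<omega> > \<tau>}"
      proof (rule finite_measure_mono)
        \<comment> \<open>Where \<open>Z n\<close> is at most \<open>\<tau>\<close>, the loss ratio
          is within \<open>4 * \<tau> \<le> \<epsilon>\<close> of 1, so the event on the left cannot
          occur.\<close>
        show "{\<omega> \<in> space M. \<bar>?Q n \<omega> - 1\<bar> > \<epsilon>} \<subseteq> {\<omega> \<in> space M. Z n \<omega> > \<tau>}"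
          using Q(2)[OF elim(2) _ _ \<tau>(2)] \<tau>(3) by (auto simp: not_le[symmetric] dest: order_trans)
      qed measurable
      with elim(1) show ?case by linarith
    qed
    with b(1) show "\<exists>b. b \<longlonglongrightarrow> 0 \<and>
      (\<forall>\<^sub>F n in sequentially. measure M {\<omega> \<in> space M. \<bar>?Q n \<omega> - 1\<bar> > \<epsilon>} \<le> b n)" by blast
  qed
  ultimately show ?thesis unfolding Z_def[abs_def] by blast
qed

end
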